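(* Let $C$ be a 2-copula. Then $C$ is stochastically monotone and idempotent if and only if $C$ is an ordinal sum of $\Pi$.
   Context: A 2-copula is a bivariate distribution function on $[0,1]^2$ with uniform margins. $\Pi(u,v)=uv$ and $C^+(u,v)=\min(u,v)$. The Markov product of 2-copulas is $(C_1*C_2)(u,v)=\int_0^1\partial_2C_1(u,t)\,\partial_1C_2(t,v)\,\mathrm{d}t$; $C$ is idempotent if $C*C=C$. $C$ is stochastically increasing (decreasing) in the first component if for every $v\in[0,1]$ the function $u\mapsto\partial_1C(u,v)$ agrees almost everywhere with a (non-strictly) decreasing (increasing) function; analogously in the second component with $v\mapsto\partial_2C(u,v)$ for every $u$. $C$ is stochastically monotone if it is stochastically increasing or stochastically decreasing. Since every idempotent 2-copula is symmetric, for idempotent $C$ it is immaterial in which of the two components this is required. Given a countable (possibly empty) family $((a_k,b_k))_{k\in\mathcal{I}}$ of pairwise disjoint intervals in $(0,1)$ (the interval $(0,1)$ itself being allowed), the corresponding ordinal sum of $\Pi$ is the 2-copula $$C(u,v)=\begin{cases}a_k+(b_k-a_k)\,\Pi\left(\frac{u-a_k}{b_k-a_k},\frac{v-a_k}{b_k-a_k}\right)&\text{if }(u,v)\in(a_k,b_k)^2\text{ for some }k\in\mathcal{I},\\ C^+(u,v)&\text{else.}\end{cases}$$ An ordinal sum of $\Pi$ is any 2-copula of this form; the empty family gives $C^+$. *)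

theory Defs
  imports "HOL-Probability.Probability"
begin

text \<open>
  A bivariate function on the unit square is represented by a total function
  \<open>real \<Rightarrow> real \<Rightarrow> real\<close>; values outside \<open>[0,1]\<^sup>2\<close> are irrelevant, so equality of
  such functions is always stated on \<open>[0,1]\<^sup>2\<close>.
\<close>

definition is_copula :: "(real \<Rightarrow> real \<Rightarrow> real) \<Rightarrow> bool" where
  "is_copula C \<longleftrightarrow>
    (\<exists>M :: (real \<times> real) measure.
       prob_space M \<and> sets M = sets borel \<and>
       distr M borel fst = uniform_measure lborel {0..1} \<and>
       distr M borel snd = uniform_measure lborel {0..1} \<and>
       (\<forall>u\<in>{0..1}. \<forall>v\<in>{0..1}. C u v = measure M ({..u} \<times> {..v})))"

definition Pi_copula :: "real \<Rightarrow> real \<Rightarrow> real" where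
  "Pi_copula u v = u * v"

definition upper_copula :: "real \<Rightarrow> real \<Rightarrow> real" where
  "upper_copula u v = min u v"

text \<open>
  The partial derivatives of a copula exist only almost everywhere along each line.
  Elsewhere \<^const>\<open>deriv\<close> has an unspecified value; everything below is insensitive
  to changes on null sets. In particular the end points 0 and 1, where the two-sided
  derivative involves values outside the unit square, do not matter.
\<close>

definition partial1 :: "(real \<Rightarrow> real \<Rightarrow> real) \<Rightarrow> real \<Rightarrow> real \<Rightarrow> real" where
  "partial1 C u v = deriv (\<lambda>x. C x v) u"

definition partial2 :: "(real \<Rightarrow> real \<Rightarrow> real) \<Rightarrow> real \<Rightarrow> real \<Rightarrow> real" where
  "partial2 C u v = deriv (\<lambda>y. C u y) v"

definition markov_product ::
  "(real \<Rightarrow> real \<Rightarrow> real) \<Rightarrow> (real \<Rightarrow> real \<Rightarrow> real) \<Rightarrow> real \<Rightarrow> real \<Rightarrow> real" where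
  "markov_product C1 C2 u v = (LINT t:{0..1}|lebesgue. partial2 C1 u t * partial1 C2 t v)"

definition idempotent_copula :: "(real \<Rightarrow> real \<Rightarrow> real) \<Rightarrow> bool" where
  "idempotent_copula C \<longleftrightarrow> (\<forall>u\<in>{0..1}. \<forall>v\<in>{0..1}. markov_product C C u v = C u v)"

text \<open>Stochastically increasing corresponds to a decreasing version of the partial derivative.\<close>

definition stoch_increasing1 :: "(real \<Rightarrow> real \<Rightarrow> real) \<Rightarrow> bool" where
  "stoch_increasing1 C \<longleftrightarrow>
    (\<forall>v\<in>{0..1}. \<exists>g :: real \<Rightarrow> real. antimono_on {0..1} g \<and>
       (AE u in lebesgue. u \<in> {0..1} \<longrightarrow> partial1 C u v = g u))"

definition stoch_decreasing1 :: "(real \<Rightarrow> real \<Rightarrow> real) \<Rightarrow> bool" where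
  "stoch_decreasing1 C \<longleftrightarrow>
    (\<forall>v\<in>{0..1}. \<exists>g :: real \<Rightarrow> real. mono_on {0..1} g \<and>
       (AE u in lebesgue. u \<in> {0..1} \<longrightarrow> partial1 C u v = g u))"

definition stoch_increasing2 :: "(real \<Rightarrow> real \<Rightarrow> real) \<Rightarrow> bool" where
  "stoch_increasing2 C \<longleftrightarrow>
    (\<forall>u\<in>{0..1}. \<exists>g :: real \<Rightarrow> real. antimono_on {0..1} g \<and>
       (AE v in lebesgue. v \<in> {0..1} \<longrightarrow> partial2 C u v = g v))"

definition stoch_decreasing2 :: "(real \<Rightarrow> real \<Rightarrow> real) \<Rightarrow> bool" where
  "stoch_decreasing2 C \<longleftrightarrow>
    (\<forall>u\<in>{0..1}. \<exists>g :: real \<Rightarrow> real. mono_on {0..1} g \<and>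
       (AE v in lebesgue. v \<in> {0..1} \<longrightarrow> partial2 C u v = g v))"

definition stoch_monotone1 :: "(real \<Rightarrow> real \<Rightarrow> real) \<Rightarrow> bool" where
  "stoch_monotone1 C \<longleftrightarrow> stoch_increasing1 C \<or> stoch_decreasing1 C"

definition stoch_monotone2 :: "(real \<Rightarrow> real \<Rightarrow> real) \<Rightarrow> bool" where
  "stoch_monotone2 C \<longleftrightarrow> stoch_increasing2 C \<or> stoch_decreasing2 C"

text \<open>
  The index set \<open>I\<close> ranges over sets of natural numbers, which covers all countable
  families, finite and empty ones included. By disjointness at most one \<open>k \<in> I\<close> applies
  to a given point \<open>(u, v)\<close>.
\<close>

definition is_ordinal_sum_of_Pi :: "(real \<Rightarrow> real \<Rightarrow> real) \<Rightarrow> bool" where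
  "is_ordinal_sum_of_Pi C \<longleftrightarrow> is_copula C \<and>
    (\<exists>(I :: nat set) (a :: nat \<Rightarrow> real) (b :: nat \<Rightarrow> real).
       (\<forall>k\<in>I. 0 \<le> a k \<and> a k < b k \<and> b k \<le> 1) \<and>
       disjoint_family_on (\<lambda>k. {a k<..<b k}) I \<and>
       (\<forall>u\<in>{0..1}. \<forall>v\<in>{0..1}.
          (\<forall>k\<in>I. u \<in> {a k<..<b k} \<and> v \<in> {a k<..<b k} \<longrightarrow>
             C u v = a k + (b k - a k) *
               Pi_copula ((u - a k) / (b k - a k)) ((v - a k) / (b k - a k))) \<and>
          (\<not> (\<exists>k\<in>I. u \<in> {a k<..<b k} \<and> v \<in> {a k<..<b k}) \<longrightarrow>
             C u v = upper_copula u v)))"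

end

theory Submission imports Defs begin

text \<open>
  Call \<open>x\<close> a cut of the copula \<open>C\<close> if \<open>C u x = min u x\<close> for all \<open>u\<close>. The cuts form a closed set
  containing \<open>0\<close> and \<open>1\<close>, and its complement splits into countably many open gaps. Outside the
  squares over the gaps every copula equals the minimum (\<open>C_outside_gap\<close>), so \<open>C\<close> is the ordinal sum
  over its gaps once it has the right bilinear form on each of these squares. This is what
  idempotency and monotonicity provide.

  Fix \<open>u\<close> and put \<open>\<phi> t = min u t - C u t\<close>. This function is nonnegative, vanishes at \<open>0\<close> and \<open>1\<close>, and
  has derivative \<open>\<phi>' t = 1\<^bsub>t \<le> u\<^esub> - \<partial>\<^sub>2C u t\<close> almost everywhere. If \<open>g\<close> is a monotone version
  of \<open>\<partial>\<^sub>1C(\<cdot>, v)\<close>, then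
  \<open>\<integral> g \<phi>' = \<integral>\<^sub>0\<^sup>u g - \<integral> \<partial>\<^sub>2C u t * \<partial>\<^sub>1C t v dt = C u v - (C * C) u v = 0\<close>. Integrating by parts
  formally gives \<open>\<integral> \<phi> dg = 0\<close>, where \<open>\<phi>\<close> is nonnegative and \<open>dg\<close> has constant sign, so \<open>g\<close> can only
  vary where \<open>\<phi>\<close> vanishes. Since this is true for every \<open>u\<close>, the version \<open>g\<close> is locally constant off
  the cuts, hence constant on each gap \<open>(a, b)\<close>. Therefore \<open>u \<mapsto> C u v\<close> is affine on \<open>[a, b]\<close>, and its
  values at \<open>a\<close> and \<open>b\<close> are known because \<open>a\<close> and \<open>b\<close> are cuts. Increasing and
  decreasing versions are thus treated alike. The rigorous form of the integration by
  parts is \<open>monotone_weight_plateau\<close>, which rests on the second mean value theorem; the conclusion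
  for copulas is \<open>C_inside_gap\<close>.

  Conversely, for an ordinal sum the function \<open>u \<mapsto> C u v\<close> has slopes \<open>1\<close>, \<open>(v - a) / (b - a)\<close> and
  \<open>0\<close> on \<open>[0, a]\<close>, \<open>[a, b]\<close> and \<open>[b, 1]\<close> for two cuts \<open>a\<close> and \<open>b\<close> around \<open>v\<close>. These slopes decrease,
  and the Markov product telescopes over the three pieces.

  Both directions need that the partial derivatives of a copula exist almost everywhere and
  integrate back to the copula. For fixed \<open>v\<close> the copula \<open>C\<close> is the distribution function of a
  measure dominated by Lebesgue measure, so the claim is the Lebesgue differentiation theorem for a
  bounded Radon--Nikodym density; it is derived from the Vitali covering theorem in
  \<open>vitali_density_comparison\<close>. Finally, exchanging the arguments of \<open>C\<close> preserves
  idempotency and ordinal sums and swaps the two notions of monotonicity, so only the first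
  component has to be treated.
\<close>

section \<open>Differentiating measures dominated by Lebesgue measure\<close>

text \<open>
  The engine of the differentiation theorem. By Vitali the small intervals around the points of \<open>A\<close>
  can be chosen disjoint, inside an open \<open>U \<supseteq> H\<close> with \<open>U - H\<close> small, and covering \<open>A\<close> up to a null set.
  On their union \<open>W\<close> the integral of \<open>a\<close> is at most that of \<open>b\<close>, whereas on \<open>W \<inter> H\<close> it is larger
  by \<open>\<delta>\<close> times the length; only the small set \<open>W - H\<close>, where \<open>b \<le> 1\<close>, can compensate, so \<open>W \<inter> H \<supseteq> A \<inter> W\<close> is small.
  Since \<open>A\<close> may be nonmeasurable, outer regularity is applied to \<open>H\<close> instead.
\<close>

lemma vitali_density_comparison:
  fixes a b :: "real \<Rightarrow> real"
  assumes a [measurable]: "a \<in> borel_measurable borel"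
    and b [measurable]: "b \<in> borel_measurable borel" and b01: "\<And>x. 0 \<le> b x" "\<And>x. b x \<le> 1"
    and H [measurable]: "H \<in> sets borel" and bH: "bounded H"
    and gap: "\<And>x. x \<in> H \<Longrightarrow> b x + \<delta> \<le> a x" and \<delta>: "\<delta> > 0"
    and AH: "A \<subseteq> H"
    and small: "\<And>x e. x \<in> A \<Longrightarrow> e > 0 \<Longrightarrow> \<exists>c r. 0 < r \<and> r < e \<and> x \<in> cball c r \<and>
      (\<integral>\<^sup>+t\<in>cball c r. a t \<partial>lborel) \<le> (\<integral>\<^sup>+t\<in>cball c r. b t \<partial>lborel)"
  shows "negligible A"
  unfolding negligible_outer
proof (intro allI impI)
  fix e :: real assume e: "e > 0"
  define \<alpha> where "\<alpha> = density lborel (\<lambda>x. ennreal (a x))"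
  define \<beta> where "\<beta> = density lborel (\<lambda>x. ennreal (b x))"
  have [measurable_cong, simp]: "sets \<alpha> = sets borel" "sets \<beta> = sets borel"
    by (simp_all add: \<alpha>_def \<beta>_def)
  have \<beta>le: "emeasure \<beta> B \<le> emeasure lborel B" if [measurable]: "B \<in> sets borel" for B
  proof -
    have "emeasure \<beta> B = (\<integral>\<^sup>+x. ennreal (b x) * indicator B x \<partial>lborel)"
      by (simp add: \<beta>_def emeasure_density)
    also have "\<dots> \<le> (\<integral>\<^sup>+x. indicator B x \<partial>lborel)"
      by (intro nn_integral_mono) (use b01 in \<open>auto simp: indicator_def ennreal_le_1\<close>)
    finally show ?thesis by simp
  qed
  \<comment> \<open>the excess \<open>\<delta> * e\<close> of the outer approximation becomes \<open>e\<close> after division by \<open>\<delta>\<close>\<close>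
  obtain U where U: "open U" "H \<subseteq> U" "U - H \<in> lmeasurable"
      and Ue: "emeasure lebesgue (U - H) < ennreal (\<delta> * e)"
    using sets_lebesgue_outer_open[of H "\<delta> * e"] \<delta> e H by auto
  have [measurable]: "U \<in> sets borel" using U by simp
  define K where "K = {(c, r). 0 < r \<and> cball c r \<subseteq> U \<and> emeasure \<alpha> (cball c r) \<le> emeasure \<beta> (cball c r)}"
  have cover: "\<exists>i. i \<in> K \<and> x \<in> cball (fst i) (snd i) \<and> snd i < d" if x: "x \<in> A" and d: "0 < d" for x d
  proof -
    obtain e' where e': "e' > 0" "ball x e' \<subseteq> U"
      using U AH x openE by blast
    obtain c r where cr: "0 < r" "r < min d (e'/2)" "x \<in> cball c r"
      "(\<integral>\<^sup>+t\<in>cball c r. a t \<partial>lborel) \<le> (\<integral>\<^sup>+t\<in>cball c r. b t \<partial>lborel)"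
      using small[OF x, of "min d (e'/2)"] d e' by auto
    have "cball c r \<subseteq> ball x e'"
      using cr by (auto simp: dist_real_def)
    then have "(c, r) \<in> K"
      using cr e' by (auto simp: K_def \<alpha>_def \<beta>_def emeasure_density)
    then show ?thesis using cr by (intro exI[of _ "(c, r)"]) auto
  qed
  obtain C where C: "countable C" "C \<subseteq> K"
     "pairwise (\<lambda>i j. disjnt (cball (fst i) (snd i)) (cball (fst j) (snd j))) C"
     "negligible (A - (\<Union>i\<in>C. cball (fst i) (snd i)))"
  proof (rule Vitali_covering_theorem_cballs[of K snd A fst])
    show "0 < snd i" if "i \<in> K" for i using that by (auto simp: K_def)
  qed (use cover in auto)
  define W where "W = (\<Union>i\<in>C. cball (fst i) (snd i))"
  have W [measurable]: "W \<in> sets borel"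
    unfolding W_def using C(1) by (intro sets.countable_UN') auto
  have WU: "W \<subseteq> U" using C(2) by (force simp: W_def K_def)
  have disj: "disjoint_family_on (\<lambda>i. cball (fst i) (snd i)) C"
    using C(3) by (auto simp: disjoint_family_on_def pairwise_def disjnt_def)
  have \<alpha>\<beta>: "emeasure \<alpha> W \<le> emeasure \<beta> W"
    unfolding W_def using C(1,2) disj
    by (subst (1 2) emeasure_UN_countable) (auto intro!: nn_integral_mono simp: K_def)
  have Hfin: "emeasure lborel (W \<inter> H) < \<infinity>"
    using bH by (intro emeasure_bounded_finite) (auto intro: bounded_subset)
  have "emeasure \<beta> (W \<inter> H) + \<delta> * emeasure lborel (W \<inter> H) \<le> emeasure \<alpha> (W \<inter> H)"
  proof -
    have "emeasure \<beta> (W \<inter> H) + \<delta> * emeasure lborel (W \<inter> H)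
       = (\<integral>\<^sup>+x. ennreal (b x) * indicator (W \<inter> H) x + ennreal \<delta> * (indicator (W \<inter> H) x :: ennreal) \<partial>lborel)"
      by (subst nn_integral_add) (auto simp: \<beta>_def emeasure_density nn_integral_cmult)
    also have "\<dots> \<le> (\<integral>\<^sup>+x. ennreal (a x) * indicator (W \<inter> H) x \<partial>lborel)"
      using gap b01 \<delta> by (intro nn_integral_mono) (auto simp: indicator_def simp flip: ennreal_plus intro!: ennreal_leI)
    also have "\<dots> = emeasure \<alpha> (W \<inter> H)" by (simp add: \<alpha>_def emeasure_density)
    finally show ?thesis .
  qed
  also have "\<dots> \<le> emeasure \<alpha> W" by (intro emeasure_mono) auto
  also note \<alpha>\<beta>
  also have "emeasure \<beta> W = emeasure \<beta> (W \<inter> H) + emeasure \<beta> (W - H)"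
    by (subst plus_emeasure) (auto intro!: arg_cong[where f = "emeasure \<beta>"])
  finally have "\<delta> * emeasure lborel (W \<inter> H) \<le> emeasure \<beta> (W - H)"
    using \<beta>le[of "W \<inter> H"] Hfin by (subst (asm) ennreal_add_left_cancel_le) (auto simp: top_unique)
  also have "\<dots> \<le> emeasure lborel (W - H)" by (intro \<beta>le) auto
  also have "\<dots> \<le> emeasure lborel (U - H)" using WU by (intro emeasure_mono) auto
  also have "\<dots> < ennreal (\<delta> * e)" using Ue by simp
  finally have "ennreal (\<delta> * measure lborel (W \<inter> H)) < ennreal (\<delta> * e)"
    using Hfin \<delta> by (simp add: emeasure_eq_ennreal_measure ennreal_mult)
  then have lt: "measure lborel (W \<inter> H) < e"
    using \<delta> e by (auto simp: ennreal_less_iff)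
  have WH: "W \<inter> H \<in> lmeasurable"
    using Hfin by (auto simp: fmeasurable_def)
  have neg: "negligible (A - W)" using C(4) by (simp add: W_def)
  show "\<exists>T. A \<subseteq> T \<and> T \<in> lmeasurable \<and> measure lebesgue T < e"
  proof (intro exI conjI)
    show "A \<subseteq> (W \<inter> H) \<union> (A - W)" using AH by auto
    show "(W \<inter> H) \<union> (A - W) \<in> lmeasurable"
      using WH neg by (intro fmeasurable.Un) (auto simp: negligible_imp_measurable)
    have "measure lebesgue ((W \<inter> H) \<union> (A - W)) = measure lebesgue (W \<inter> H)"
      using WH neg by (intro measure_Un_null_set) (auto simp: negligible_iff_null_sets fmeasurableD)
    then show "measure lebesgue ((W \<inter> H) \<union> (A - W)) < e" using lt by simp
  qed
qed

text \<open>
  If \<open>F\<close> fails to have derivative \<open>h x\<close> at \<open>x\<close>, then some rational \<open>q\<close> lies strictly between \<open>h x\<close> and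
  the slopes of \<open>F\<close> over arbitrarily short intervals around \<open>x\<close>. For each \<open>q\<close> and each side such points
  form a null set, by comparing the densities \<open>h\<close> and the constant \<open>q\<close>. The index \<open>n\<close> in the
  proof keeps \<open>x\<close> in a bounded set and the distance of \<open>q\<close> from \<open>h x\<close> at least \<open>1 / Suc n\<close>.
\<close>

lemma indefinite_integral_AE_has_derivative:
  fixes h F :: "real \<Rightarrow> real"
  assumes h [measurable]: "h \<in> borel_measurable borel" and h01: "\<And>x. 0 \<le> h x" "\<And>x. h x \<le> 1"
    and F: "\<And>s t. s \<le> t \<Longrightarrow> (h has_integral (F t - F s)) {s..t}"
  shows "negligible {x. \<not> (F has_real_derivative h x) (at x)}"
proof -
  have int_h: "(\<integral>\<^sup>+t\<in>cball c r. h t \<partial>lborel) = ennreal (F (c + r) - F (c - r))" if "0 < r" for c r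
    using nn_integral_has_integral_lebesgue'[OF _ F[of "c - r" "c + r"]] that h01
    by (simp add: cball_eq_atLeastAtMost)
  have int_c: "(\<integral>\<^sup>+t\<in>cball c r. ennreal q \<partial>lborel) = ennreal (q * (2 * r))" if "0 < r" "0 \<le> q" for c r q :: real
    using that by (simp add: cball_eq_atLeastAtMost nn_integral_cmult_indicator ennreal_mult)
  have mono: "0 \<le> F t - F s" if "s \<le> t" for s t
    using has_integral_nonneg[OF F[OF that]] h01 by auto
  define near where "near x e s t \<longleftrightarrow> s \<le> x \<and> x \<le> t \<and> s < t \<and> t - s < e" for x e s t :: real
  \<comment> \<open>points with intervals that are too steep, respectively too flat, compared with the density\<close>
  define up where "up q n = {x \<in> ball 0 (real n). h x + 1 / Suc n \<le> q \<and>
      (\<forall>e>0. \<exists>s t. near x e s t \<and> q * (t - s) \<le> F t - F s)}" for q n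
  define lo where "lo q n = {x \<in> ball 0 (real n). q + 1 / Suc n \<le> h x \<and>
      (\<forall>e>0. \<exists>s t. near x e s t \<and> F t - F s \<le> q * (t - s))}" for q n
  have ball: "\<exists>c r. 0 < r \<and> r < e \<and> x \<in> cball c r \<and> s = c - r \<and> t = c + r" if "near x e s t" for x e s t
    using that by (intro exI[of _ "(s + t) / 2"] exI[of _ "(t - s) / 2"])
       (auto simp: near_def cball_eq_atLeastAtMost field_simps)
  have up: "negligible (up q n)" for q n
  proof (cases "0 \<le> q")
    case True
    show ?thesis
    proof (rule vitali_density_comparison[where a = "\<lambda>_. q" and b = h and \<delta> = "1 / Suc n"
          and H = "ball 0 (real n) \<inter> {x. h x + 1 / Suc n \<le> q}"])
      fix x e :: real assume x: "x \<in> up q n" and "e > 0"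
      then obtain s t where st: "near x e s t" "q * (t - s) \<le> F t - F s"
        by (auto simp: up_def)
      obtain c r where cr: "0 < r" "r < e" "x \<in> cball c r" "s = c - r" "t = c + r"
        using ball[OF st(1)] by blast
      show "\<exists>c r. 0 < r \<and> r < e \<and> x \<in> cball c r \<and>
        (\<integral>\<^sup>+t\<in>cball c r. ennreal q \<partial>lborel) \<le> (\<integral>\<^sup>+t\<in>cball c r. ennreal (h t) \<partial>lborel)"
        using cr st by (intro exI[of _ c] exI[of _ r]) (auto simp: int_h int_c True intro!: ennreal_leI)
    qed (use h01 in \<open>auto simp: up_def intro!: bounded_Int\<close>)
  next
    case False
    have "x \<notin> up q n" for x
    proof
      assume "x \<in> up q n"
      then have "h x + 1 / Suc n \<le> q" "0 \<le> 1 / real (Suc n)" by (simp_all add: up_def)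
      then show False using False h01(1)[of x] by linarith
    qed
    then have "up q n = {}" by blast
    then show ?thesis by simp
  qed
  have lo: "negligible (lo q n)" for q n
  proof (cases "0 \<le> q \<and> q \<le> 1")
    case True
    show ?thesis
    proof (rule vitali_density_comparison[where b = "\<lambda>_. q" and a = h and \<delta> = "1 / Suc n"
          and H = "ball 0 (real n) \<inter> {x. q + 1 / Suc n \<le> h x}"])
      fix x e :: real assume x: "x \<in> lo q n" and "e > 0"
      then obtain s t where st: "near x e s t" "F t - F s \<le> q * (t - s)"
        by (auto simp: lo_def)
      obtain c r where cr: "0 < r" "r < e" "x \<in> cball c r" "s = c - r" "t = c + r"
        using ball[OF st(1)] by blast
      show "\<exists>c r. 0 < r \<and> r < e \<and> x \<in> cball c r \<and>
        (\<integral>\<^sup>+t\<in>cball c r. ennreal (h t) \<partial>lborel) \<le> (\<integral>\<^sup>+t\<in>cball c r. ennreal q \<partial>lborel)"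
        using cr st True by (intro exI[of _ c] exI[of _ r]) (auto simp: int_h int_c intro!: ennreal_leI)
    qed (use h01 True in \<open>auto simp: lo_def intro!: bounded_Int\<close>)
  next
    case False
    have "x \<notin> lo q n" for x
    proof
      assume x: "x \<in> lo q n"
      then have "\<exists>s t. near x 1 s t \<and> F t - F s \<le> q * (t - s)"
        by (simp add: lo_def)
      then obtain s t where st: "near x 1 s t" "F t - F s \<le> q * (t - s)" by blast
      then have "0 \<le> q * (t - s)" using mono[of s t] by (auto simp: near_def)
      then have "0 \<le> q" using st by (auto simp: near_def zero_le_mult_iff)
      have "q + 1 / Suc n \<le> h x" "0 \<le> 1 / real (Suc n)" using x by (simp_all add: lo_def)
      then have "q \<le> 1" using h01(2)[of x] by linarith
      with \<open>0 \<le> q\<close> show False using False by simp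
    qed
    then have "lo q n = {}" by blast
    then show ?thesis by simp
  qed
  define N where "N = (\<Union>i :: rat \<times> nat. up (of_rat (fst i)) (snd i) \<union> lo (of_rat (fst i)) (snd i))"
  have "negligible N"
    unfolding N_def negligible_iff_null_sets using up lo
    by (intro null_sets_UN) (auto simp: negligible_iff_null_sets)
  moreover have "(F has_real_derivative h x) (at x)" if x: "x \<notin> N" for x
  proof -
    have slope: "\<exists>d>0. \<forall>s t. near x d s t \<longrightarrow> \<bar>F t - F s - h x * (t - s)\<bar> \<le> e * (t - s)" if e: "e > 0" for e
    proof -
      obtain q1 where q1: "h x < of_rat q1" "of_rat q1 < h x + e" using of_rat_dense[of "h x" "h x + e"] e by auto
      obtain q2 where q2: "h x - e < of_rat q2" "of_rat q2 < h x" using of_rat_dense[of "h x - e" "h x"] e by auto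
      obtain n1 where n1: "norm x < real n1" using reals_Archimedean2 by blast
      obtain n2 where n2: "1 / Suc n2 < min (of_rat q1 - h x) (h x - of_rat q2)"
        using nat_approx_posE[of "min (of_rat q1 - h x) (h x - of_rat q2)"] q1 q2 by auto
      define n where "n = max n1 n2"
      have "1 / Suc n \<le> 1 / Suc n2" by (simp add: n_def field_simps)
      then have n: "x \<in> ball 0 (real n)" "h x + 1 / Suc n \<le> of_rat q1" "of_rat q2 + 1 / Suc n \<le> h x"
        using n1 n2 by (auto simp: n_def)
      have "x \<notin> up (of_rat q1) n" "x \<notin> lo (of_rat q2) n"
        using x[unfolded N_def] UN_I[of "(q1, n)" UNIV x] UN_I[of "(q2, n)" UNIV x] by auto
      then have "\<not> (\<forall>e>0. \<exists>s t. near x e s t \<and> of_rat q1 * (t - s) \<le> F t - F s)"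
        and "\<not> (\<forall>e>0. \<exists>s t. near x e s t \<and> F t - F s \<le> of_rat q2 * (t - s))"
        using n unfolding up_def lo_def by blast+
      then obtain d1 d2 where d: "d1 > 0" "\<And>s t. near x d1 s t \<Longrightarrow> F t - F s < of_rat q1 * (t - s)"
         "d2 > 0" "\<And>s t. near x d2 s t \<Longrightarrow> of_rat q2 * (t - s) < F t - F s"
        unfolding not_all not_imp not_ex de_Morgan_conj not_le by blast
      show ?thesis
      proof (intro exI[of _ "min d1 d2"] conjI allI impI)
        fix s t assume st: "near x (min d1 d2) s t"
        have "near x d1 s t" "near x d2 s t" using st by (auto simp: near_def)
        note this(1)[THEN d(2)] this(2)[THEN d(4)]
        moreover have "of_rat q1 * (t - s) \<le> (h x + e) * (t - s)" "(h x - e) * (t - s) \<le> of_rat q2 * (t - s)"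
          using q1 q2 st by (auto simp: near_def intro!: mult_right_mono)
        ultimately show "\<bar>F t - F s - h x * (t - s)\<bar> \<le> e * (t - s)"
          by (simp add: algebra_simps abs_le_iff)
      qed (use d in auto)
    qed
    show ?thesis
      unfolding has_field_derivative_def has_derivative_at_alt
    proof (intro conjI allI impI)
      fix e :: real assume "e > 0"
      then obtain d where d: "d > 0" "\<And>s t. near x d s t \<Longrightarrow> \<bar>F t - F s - h x * (t - s)\<bar> \<le> e * (t - s)"
        using slope by blast
      have "norm (F y - F x - h x * (y - x)) \<le> e * norm (y - x)" if "norm (y - x) < d" for y
      proof (cases x y rule: linorder_cases)
        case less
        then show ?thesis using d(2)[of x y] that by (auto simp: near_def)
      next
        case greater
        then show ?thesis using d(2)[of y x] that by (auto simp: near_def abs_if algebra_simps split: if_splits)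
      qed simp
      then show "\<exists>d>0. \<forall>y. norm (y - x) < d \<longrightarrow> norm (F y - F x - h x * (y - x)) \<le> e * norm (y - x)"
        using d(1) by blast
    qed (simp add: bounded_linear_mult_right)
  qed
  then have "{x. \<not> (F has_real_derivative h x) (at x)} \<subseteq> N" by blast
  ultimately show ?thesis by (rule negligible_subset)
qed

text \<open>
  Radon--Nikodym gives an extended-real density \<open>f\<close>, and domination by Lebesgue measure forces \<open>f \<le> 1\<close>
  almost everywhere, because \<open>\<nu>\<close> would exceed Lebesgue measure on \<open>{f \<ge> 1 + 1/n}\<close>.
\<close>

lemma measure_le_lborel_density:
  assumes sets: "sets \<nu> = sets borel" and le: "\<And>B. B \<in> sets borel \<Longrightarrow> emeasure \<nu> B \<le> emeasure lborel B"
  obtains h :: "real \<Rightarrow> real" where "h \<in> borel_measurable borel" "\<And>x. 0 \<le> h x" "\<And>x. h x \<le> 1"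
    "\<nu> = density lborel h"
proof -
  have "absolutely_continuous lborel \<nu>"
    using le by (force simp: absolutely_continuous_def null_sets_def sets)
  then obtain f where f [measurable]: "f \<in> borel_measurable borel" and \<nu>: "density lborel f = \<nu>"
    using sigma_finite_measure.Radon_Nikodym[OF sigma_finite_lborel, of \<nu>] sets by auto
  define D where "D n = {x \<in> ball 0 (real n). 1 + ennreal (1 / Suc n) \<le> f x}" for n
  have [measurable]: "D n \<in> sets borel" for n unfolding D_def by measurable
  have "emeasure lborel (D n) = 0" for n
  proof -
    have fin: "emeasure lborel (D n) < \<infinity>"
      by (intro emeasure_bounded_finite bounded_subset[OF bounded_ball[of 0 "real n"]]) (auto simp: D_def)
    have "emeasure lborel (D n) + ennreal (1 / Suc n) * emeasure lborel (D n)
        = (\<integral>\<^sup>+x. (1 + ennreal (1 / Suc n)) * indicator (D n) x \<partial>lborel)"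
      by (subst nn_integral_cmult_indicator) (auto simp: distrib_right)
    also have "\<dots> \<le> (\<integral>\<^sup>+x. f x * indicator (D n) x \<partial>lborel)"
      by (intro nn_integral_mono) (auto simp: indicator_def D_def)
    also have "\<dots> = emeasure \<nu> (D n)" by (simp add: \<nu>[symmetric] emeasure_density)
    also have "\<dots> \<le> emeasure lborel (D n) + 0" using le[of "D n"] by simp
    finally have "ennreal (1 / Suc n) * emeasure lborel (D n) \<le> 0"
      using fin by (subst (asm) ennreal_add_left_cancel_le) (auto simp: top_unique)
    then show ?thesis by (simp add: ennreal_eq_0_iff)
  qed
  then have "(\<Union>n. D n) \<in> null_sets lborel"
    by (intro null_sets_UN) (auto simp: null_sets_def)
  moreover have "f x \<le> 1" if "x \<notin> (\<Union>n. D n)" for x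
  proof (rule ennreal_le_epsilon)
    fix e :: real assume "e > 0"
    obtain n1 where n1: "norm x < real n1" using reals_Archimedean2 by blast
    obtain n2 where n2: "1 / Suc n2 < e" using nat_approx_posE[OF \<open>e > 0\<close>] by auto
    define n where "n = max n1 n2"
    have "1 / Suc n \<le> 1 / Suc n2" by (simp add: n_def field_simps)
    then have "1 / Suc n \<le> e" "x \<in> ball 0 (real n)" using n1 n2 by (auto simp: n_def)
    then have "f x \<le> 1 + ennreal (1 / Suc n)" using that[unfolded UN_iff] by (auto simp: D_def not_le)
    also have "\<dots> \<le> 1 + ennreal e" using \<open>1 / Suc n \<le> e\<close> by (intro add_mono ennreal_leI) auto
    finally show "f x \<le> 1 + ennreal e" .
  qed
  ultimately have AE: "AE x in lborel. f x \<le> 1"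
    by (auto intro!: AE_I'[of "\<Union>n. D n"])
  define h where "h x = enn2real (min 1 (f x))" for x
  have h: "ennreal (h x) = min 1 (f x)" for x
    by (simp add: h_def ennreal_enn2real_if min_def top_unique)
  show thesis
  proof
    show "h \<in> borel_measurable borel" unfolding h_def by measurable
    then show "\<nu> = density lborel h"
      unfolding \<nu>[symmetric] using AE by (intro density_cong) (auto simp: h min_def)
    show "0 \<le> h x" "h x \<le> 1" for x using h[of x] by (auto simp: h_def intro: enn2real_leI)
  qed
qed

lemma measure_le_lborel_AE_derivative:
  assumes sets: "sets \<nu> = sets borel" and fin: "finite_measure \<nu>"
    and le: "\<And>B. B \<in> sets borel \<Longrightarrow> emeasure \<nu> B \<le> emeasure lborel B"
  obtains h :: "real \<Rightarrow> real" where "h \<in> borel_measurable borel" "\<And>x. 0 \<le> h x" "\<And>x. h x \<le> 1"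
    "\<And>s t. s \<le> t \<Longrightarrow> (h has_integral (measure \<nu> {..t} - measure \<nu> {..s})) {s..t}"
    "negligible {x. \<not> ((\<lambda>t. measure \<nu> {..t}) has_real_derivative h x) (at x)}"
proof -
  interpret finite_measure \<nu> by (rule fin)
  obtain h :: "real \<Rightarrow> real" where h [measurable]: "h \<in> borel_measurable borel"
     and h01: "\<And>x. 0 \<le> h x" "\<And>x. h x \<le> 1" and \<nu>: "\<nu> = density lborel h"
    using measure_le_lborel_density[OF sets le] by auto
  have int: "(h has_integral (measure \<nu> {..t} - measure \<nu> {..s})) {s..t}" if "s \<le> t" for s t
  proof -
    have null: "measure \<nu> {s} = 0" using le[of "{s}"] by (simp add: measure_def)
    have "measure \<nu> {s..t} = measure \<nu> ({..t} - {..s}) + measure \<nu> {s}"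
      using that by (subst finite_measure_Union[symmetric]) (auto simp: sets intro!: arg_cong[where f="measure \<nu>"])
    also have "\<dots> = measure \<nu> {..t} - measure \<nu> {..s}"
      using that null by (subst finite_measure_Diff) (auto simp: sets)
    finally have "measure \<nu> {..t} - measure \<nu> {..s} = measure \<nu> {s..t}" by simp
    moreover have "ennreal (measure \<nu> {s..t}) = (\<integral>\<^sup>+x. ennreal (h x * indicator {s..t} x) \<partial>lborel)"
    proof -
      have "ennreal (measure \<nu> {s..t}) = emeasure \<nu> {s..t}" by (rule emeasure_eq_measure[symmetric])
      also have "\<dots> = (\<integral>\<^sup>+x. ennreal (h x * indicator {s..t} x) \<partial>lborel)"
        unfolding \<nu> by (subst emeasure_density) (auto intro!: nn_integral_cong simp: indicator_def)
      finally show ?thesis .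
    qed
    ultimately have "((\<lambda>x. h x * indicator {s..t} x) has_integral (measure \<nu> {..t} - measure \<nu> {..s})) UNIV"
      using h01 by (intro nn_integral_has_integral) auto
    then have "((\<lambda>x. if x \<in> {s..t} then h x else 0) has_integral (measure \<nu> {..t} - measure \<nu> {..s})) UNIV"
      by (rule has_integral_eq[rotated]) (auto simp: indicator_def)
    then show ?thesis by (simp only: has_integral_restrict_UNIV)
  qed
  from that[OF h h01 int indefinite_integral_AE_has_derivative[OF h h01 int]] show thesis .
qed

lemma AE_lebesgue_iff_negligible: "(AE x in lebesgue. P x) \<longleftrightarrow> negligible {x. \<not> P x}"
  unfolding negligible_iff_null_sets eventually_ae_filter
  by (auto simp flip: negligible_iff_null_sets intro: negligible_subset)

section \<open>Plateaus of a monotone weight\<close>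

text \<open>
  Formally \<open>\<integral> \<phi> dg = - \<integral> g \<phi>' = 0\<close> with \<open>\<phi> \<ge> 0\<close> and \<open>dg \<ge> 0\<close>, so \<open>g\<close> cannot grow where \<open>\<phi>\<close> is positive.
  Applying the second mean value theorem on \<open>[0, p]\<close>, \<open>[p, q]\<close> and \<open>[q, 1]\<close> replaces the Stieltjes integral
  by the finite sum \<open>(g p - g 0) \<phi> c\<^sub>1 + (g q - g p) \<phi> c\<^sub>2 + (g 1 - g q) \<phi> c\<^sub>3\<close> of nonnegative terms.
\<close>

lemma mono_weight_plateau:
  fixes \<phi> \<phi>' g :: "real \<Rightarrow> real"
  assumes int: "\<And>s t. \<lbrakk>0 \<le> s; s \<le> t; t \<le> 1\<rbrakk> \<Longrightarrow> (\<phi>' has_integral (\<phi> t - \<phi> s)) {s..t}"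
    and nonneg: "\<And>t. \<lbrakk>0 \<le> t; t \<le> 1\<rbrakk> \<Longrightarrow> 0 \<le> \<phi> t" and ends: "\<phi> 0 = 0" "\<phi> 1 = 0"
    and g: "mono_on {0..1} g"
    and zero: "((\<lambda>t. g t * \<phi>' t) has_integral 0) {0..1}"
    and pq: "0 \<le> p" "p < q" "q \<le> 1" and pos: "\<And>t. \<lbrakk>p \<le> t; t \<le> q\<rbrakk> \<Longrightarrow> 0 < \<phi> t"
  shows "g p = g q"
proof -
  have gle: "g x \<le> g y" if "0 \<le> x" "x \<le> y" "y \<le> 1" for x y
    by (rule monotone_onD[OF g]) (use that in simp_all)
  have piece: "\<exists>c\<in>{s..t}. ((\<lambda>x. g x * \<phi>' x) has_integral (g s * (\<phi> c - \<phi> s) + g t * (\<phi> t - \<phi> c))) {s..t}"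
    if st: "0 \<le> s" "s \<le> t" "t \<le> 1" for s t
  proof -
    have I: "\<phi>' integrable_on {s..t}" using int[OF st] by blast
    obtain c where c: "c \<in> {s..t}"
      "((\<lambda>x. g x * \<phi>' x) has_integral (g s * integral {s..c} \<phi>' + g t * integral {c..t} \<phi>')) {s..t}"
    proof (rule second_mean_value_theorem_full[OF I st(2), of g])
      show "g x \<le> g y" if "s \<le> x" "x \<le> y" "y \<le> t" for x y
        using gle[of x y] that st by linarith
    qed
    have "integral {s..c} \<phi>' = \<phi> c - \<phi> s" "integral {c..t} \<phi>' = \<phi> t - \<phi> c"
      using c(1) st by (auto intro!: integral_unique int)
    with c show ?thesis by auto
  qed
  obtain c1 where c1: "c1 \<in> {0..p}"
    "((\<lambda>x. g x * \<phi>' x) has_integral (g 0 * (\<phi> c1 - \<phi> 0) + g p * (\<phi> p - \<phi> c1))) {0..p}"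
    using piece[of 0 p] pq by auto
  obtain c2 where c2: "c2 \<in> {p..q}"
    "((\<lambda>x. g x * \<phi>' x) has_integral (g p * (\<phi> c2 - \<phi> p) + g q * (\<phi> q - \<phi> c2))) {p..q}"
    using piece[of p q] pq by auto
  obtain c3 where c3: "c3 \<in> {q..1}"
    "((\<lambda>x. g x * \<phi>' x) has_integral (g q * (\<phi> c3 - \<phi> q) + g 1 * (\<phi> 1 - \<phi> c3))) {q..1}"
    using piece[of q 1] pq by auto
  have "(g p - g 0) * \<phi> c1 + (g q - g p) * \<phi> c2 + (g 1 - g q) * \<phi> c3 = 0"
    using has_integral_unique[OF zero has_integral_combine[OF _ _ c1(2) has_integral_combine[OF _ _ c2(2) c3(2)]]]
      pq ends by (simp add: algebra_simps)
  moreover have "0 \<le> (g p - g 0) * \<phi> c1" "0 \<le> (g 1 - g q) * \<phi> c3"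
    using pq c1 c3 by (auto intro!: mult_nonneg_nonneg gle nonneg)
  ultimately have "(g q - g p) * \<phi> c2 \<le> 0" by linarith
  then have "g q \<le> g p" using pos[of c2] c2(1) by (auto simp: mult_le_0_iff)
  then show ?thesis using gle[of p q] pq by simp
qed

lemma monotone_weight_plateau:
  fixes \<phi> \<phi>' g :: "real \<Rightarrow> real"
  assumes int: "\<And>s t. \<lbrakk>0 \<le> s; s \<le> t; t \<le> 1\<rbrakk> \<Longrightarrow> (\<phi>' has_integral (\<phi> t - \<phi> s)) {s..t}"
    and nonneg: "\<And>t. \<lbrakk>0 \<le> t; t \<le> 1\<rbrakk> \<Longrightarrow> 0 \<le> \<phi> t" and ends: "\<phi> 0 = 0" "\<phi> 1 = 0"
    and g: "mono_on {0..1} g \<or> antimono_on {0..1} g"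
    and zero: "((\<lambda>t. g t * \<phi>' t) has_integral 0) {0..1}"
    and pq: "0 \<le> p" "p < q" "q \<le> 1" and pos: "\<And>t. \<lbrakk>p \<le> t; t \<le> q\<rbrakk> \<Longrightarrow> 0 < \<phi> t"
  shows "g p = g q"
  using g
proof
  assume "mono_on {0..1} g"
  from mono_weight_plateau[OF int nonneg ends this zero pq pos] show ?thesis .
next
  assume "antimono_on {0..1} g"
  note anti = this
  have m: "mono_on {0..1} (\<lambda>t. - g t)"
  proof (rule monotone_onI)
    fix x y :: real assume "x \<in> {0..1}" "y \<in> {0..1}" "x \<le> y"
    from monotone_onD[OF anti this] show "- g x \<le> - g y" by (simp only: neg_le_iff_le)
  qed
  have z: "((\<lambda>t. - g t * \<phi>' t) has_integral 0) {0..1}"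
    using has_integral_neg[OF zero] by simp
  from mono_weight_plateau[OF int nonneg ends m z pq pos] show ?thesis by simp
qed

lemma has_integral_step:
  fixes s t u :: real
  assumes "s \<le> t"
  shows "((\<lambda>x. if x \<le> u then 1 else 0) has_integral (min u t - min u s)) {s..t}"
proof (rule fundamental_theorem_of_calculus_interior_strong[where S = "{u}"])
  fix x assume x: "x \<in> {s<..<t} - {u}"
  show "(min u has_vector_derivative (if x \<le> u then 1 else 0)) (at x)"
  proof (cases "x < u")
    case True
    have "((\<lambda>x. x) has_vector_derivative 1) (at x)" by (auto intro!: derivative_eq_intros)
    then have "(min u has_vector_derivative 1) (at x)"
      by (rule has_vector_derivative_transform_within_open[of _ _ _ "{..<u}"]) (use True in auto)
    then show ?thesis using True by simp
  next
    case False
    have "((\<lambda>x. u) has_vector_derivative 0) (at x)" by (auto intro!: derivative_eq_intros)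
    then have "(min u has_vector_derivative 0) (at x)"
      by (rule has_vector_derivative_transform_within_open[of _ _ _ "{u<..}"]) (use False x in auto)
    then show ?thesis using False x by simp
  qed
qed (use assms in \<open>auto intro!: continuous_intros\<close>)

section \<open>Margins and partial derivatives of a copula\<close>

locale copula =
  fixes C :: "real \<Rightarrow> real \<Rightarrow> real"
  assumes is_copula: "is_copula C"

lemma is_copula_transpose:
  assumes "is_copula C"
  shows "is_copula (\<lambda>u v. C v u)"
proof -
  obtain M :: "(real \<times> real) measure" where M: "prob_space M" "sets M = sets borel"
     "distr M borel fst = uniform_measure lborel {0..1}" "distr M borel snd = uniform_measure lborel {0..1}"
     and C: "\<And>u v. u \<in> {0..1} \<Longrightarrow> v \<in> {0..1} \<Longrightarrow> C u v = measure M ({..u} \<times> {..v})"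
    using assms by (auto simp: is_copula_def)
  note [measurable_cong] = M(2)
  have fs [measurable]: "fst \<in> borel_measurable (borel :: (real \<times> real) measure)"
       "snd \<in> borel_measurable (borel :: (real \<times> real) measure)"
    by (intro borel_measurable_continuous_onI continuous_intros)+
  have sw [measurable]: "prod.swap \<in> measurable (borel :: (real \<times> real) measure) borel"
    by (intro borel_measurable_continuous_onI continuous_on_swap)
  define M' where "M' = distr M borel (prod.swap :: real \<times> real \<Rightarrow> real \<times> real)"
  have "prob_space M'" unfolding M'_def by (intro prob_space.prob_space_distr M(1)) measurable
  moreover have "sets M' = sets borel" by (simp add: M'_def)
  moreover have "distr M' borel fst = uniform_measure lborel {0..1}"
    unfolding M'_def M(4)[symmetric] by (subst distr_distr) (auto intro!: distr_cong)
  moreover have "distr M' borel snd = uniform_measure lborel {0..1}"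
    unfolding M'_def M(3)[symmetric] by (subst distr_distr) (auto intro!: distr_cong)
  moreover have "C v u = measure M' ({..u} \<times> {..v})" if "u \<in> {0..1}" "v \<in> {0..1}" for u v
  proof -
    have "space M = UNIV" using sets_eq_imp_space_eq[OF M(2)] by simp
    then have "prod.swap -` ({..u} \<times> {..v}) \<inter> space M = {..v} \<times> {..u}" by auto
    then show ?thesis using that C
      by (subst M'_def, subst measure_distr) (auto intro!: borel_Times)
  qed
  ultimately show ?thesis unfolding is_copula_def by blast
qed

context copula
begin

lemma transpose: "copula (\<lambda>u v. C v u)"
  by unfold_locales (rule is_copula_transpose[OF is_copula])

lemma coupling:
  obtains M :: "(real \<times> real) measure" where "prob_space M" "sets M = sets borel"
    "\<And>B. B \<in> sets borel \<Longrightarrow> emeasure M (B \<times> UNIV) = emeasure lborel (B \<inter> {0..1})"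
    "\<And>B. B \<in> sets borel \<Longrightarrow> emeasure M (UNIV \<times> B) = emeasure lborel (B \<inter> {0..1})"
    "\<And>u v. u \<in> {0..1} \<Longrightarrow> v \<in> {0..1} \<Longrightarrow> C u v = measure M ({..u} \<times> {..v})"
proof -
  obtain M :: "(real \<times> real) measure" where M: "prob_space M" "sets M = sets borel"
     "distr M borel fst = uniform_measure lborel {0..1}" "distr M borel snd = uniform_measure lborel {0..1}"
     and C: "\<And>u v. u \<in> {0..1} \<Longrightarrow> v \<in> {0..1} \<Longrightarrow> C u v = measure M ({..u} \<times> {..v})"
    using is_copula by (auto simp: is_copula_def)
  note [measurable_cong] = M(2)
  have fs [measurable]: "fst \<in> borel_measurable (borel :: (real \<times> real) measure)"
       "snd \<in> borel_measurable (borel :: (real \<times> real) measure)"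
    by (intro borel_measurable_continuous_onI continuous_intros)+
  have sp: "space M = UNIV" using sets_eq_imp_space_eq[OF M(2)] by simp
  have uni: "emeasure (uniform_measure lborel {0..1}) B = emeasure lborel (B \<inter> {0..1})"
    if "B \<in> sets borel" for B :: "real set"
    using that by (simp add: emeasure_uniform_measure Int_commute divide_ennreal_def)
  show thesis
  proof
    fix B :: "real set" assume [measurable]: "B \<in> sets borel"
    have "emeasure (distr M borel fst) B = emeasure M (B \<times> UNIV)"
      by (subst emeasure_distr) (auto simp: sp intro!: arg_cong[where f = "emeasure M"])
    then show "emeasure M (B \<times> UNIV) = emeasure lborel (B \<inter> {0..1})"
      using uni[of B] by (simp add: M)
    have "emeasure (distr M borel snd) B = emeasure M (UNIV \<times> B)"
      by (subst emeasure_distr) (auto simp: sp intro!: arg_cong[where f = "emeasure M"])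
    then show "emeasure M (UNIV \<times> B) = emeasure lborel (B \<inter> {0..1})"
      using uni[of B] by (simp add: M)
  qed (use M C in auto)
qed

text \<open>
  The difference of the two sides is the mass of the rectangle \<open>(u, u'] \<times> (v, v']\<close>.
\<close>

lemma two_increasing:
  assumes "0 \<le> u" "u \<le> u'" "u' \<le> 1" "0 \<le> v" "v \<le> v'" "v' \<le> 1"
  shows "C u' v - C u v \<le> C u' v' - C u v'"
proof -
  obtain M :: "(real \<times> real) measure" where M: "prob_space M" "sets M = sets borel"
    "\<And>B. B \<in> sets borel \<Longrightarrow> emeasure M (B \<times> UNIV) = emeasure lborel (B \<inter> {0..1})"
    "\<And>B. B \<in> sets borel \<Longrightarrow> emeasure M (UNIV \<times> B) = emeasure lborel (B \<inter> {0..1})"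
    and C: "\<And>u v. u \<in> {0..1} \<Longrightarrow> v \<in> {0..1} \<Longrightarrow> C u v = measure M ({..u} \<times> {..v})"
    by (rule coupling) (rule that)
  interpret prob_space M by (rule M)
  have diff: "C u' w - C u w = measure M ({u<..u'} \<times> {..w})" if "w \<in> {0..1}" for w
  proof -
    have "measure M ({..u'} \<times> {..w}) = measure M ({..u} \<times> {..w}) + measure M ({u<..u'} \<times> {..w})"
      using assms by (subst finite_measure_Union[symmetric])
        (auto simp: M intro!: borel_Times arg_cong[where f = "measure M"])
    then show ?thesis using that assms C by auto
  qed
  have "measure M ({u<..u'} \<times> {..v}) \<le> measure M ({u<..u'} \<times> {..v'})"
    using assms by (intro finite_measure_mono) (auto simp: M intro!: borel_Times)
  then show ?thesis using diff assms by auto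
qed

lemma margins:
  assumes "u \<in> {0..1}"
  shows "C u 0 = 0" "C u 1 = u"
proof -
  obtain M :: "(real \<times> real) measure" where M: "prob_space M" "sets M = sets borel"
    "\<And>B. B \<in> sets borel \<Longrightarrow> emeasure M (B \<times> UNIV) = emeasure lborel (B \<inter> {0..1})"
    "\<And>B. B \<in> sets borel \<Longrightarrow> emeasure M (UNIV \<times> B) = emeasure lborel (B \<inter> {0..1})"
    and C: "\<And>u v. u \<in> {0..1} \<Longrightarrow> v \<in> {0..1} \<Longrightarrow> C u v = measure M ({..u} \<times> {..v})"
    by (rule coupling) (rule that)
  interpret prob_space M by (rule M)
  have "measure M ({..u} \<times> {..0}) \<le> measure M (UNIV \<times> {..0})"
    by (intro finite_measure_mono) (auto simp: M intro!: borel_Times)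
  also have "{..0} \<inter> {0..1::real} = {0}" by auto
  then have "measure M (UNIV \<times> {..0}) = 0"
    by (simp add: measure_def M(4))
  finally show "C u 0 = 0" using C[of u 0] assms by (simp add: antisym)
  have "measure M ({..u} \<times> {1<..}) \<le> measure M (UNIV \<times> {1<..})"
    by (intro finite_measure_mono) (auto simp: M intro!: borel_Times)
  also have "{1<..} \<inter> {0..1::real} = {}" by auto
  then have "measure M (UNIV \<times> {1<..}) = 0"
    by (simp add: measure_def M(4))
  finally have "measure M ({..u} \<times> {1<..}) = 0" by (simp add: antisym)
  moreover have "measure M ({..u} \<times> UNIV) = measure M ({..u} \<times> {..1}) + measure M ({..u} \<times> {1<..})"
    by (subst finite_measure_Union[symmetric])
      (auto simp: M intro!: borel_Times arg_cong[where f = "measure M"])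
  moreover have "{..u} \<inter> {0..1} = {0..u}" using assms by auto
  then have "measure M ({..u} \<times> UNIV) = u"
    using assms by (simp add: measure_def M(3))
  ultimately show "C u 1 = u" using C[of u 1] assms by simp
qed

lemma margins':
  assumes "v \<in> {0..1}"
  shows "C 0 v = 0" "C 1 v = v"
  using copula.margins[OF transpose assms] by auto

text \<open>
  The mass of \<open>B \<times> (-\<infinity>, v]\<close> is a measure in \<open>B\<close> that is dominated by the uniform margin and has
  distribution function \<open>C(\<cdot>, v)\<close> on the unit interval. The points \<open>0\<close> and \<open>1\<close> are discarded since
  \<^const>\<open>deriv\<close> there depends on values of \<open>C\<close> outside the unit square.
\<close>

lemma partial1_density:
  assumes v: "v \<in> {0..1}"
  obtains h :: "real \<Rightarrow> real" where "h \<in> borel_measurable borel" "\<And>x. 0 \<le> h x" "\<And>x. h x \<le> 1"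
    "\<And>s t. \<lbrakk>0 \<le> s; s \<le> t; t \<le> 1\<rbrakk> \<Longrightarrow> (h has_integral (C t v - C s v)) {s..t}"
    "negligible {t \<in> {0..1}. partial1 C t v \<noteq> h t}"
proof -
  obtain M :: "(real \<times> real) measure" where M: "prob_space M" "sets M = sets borel"
    "\<And>B. B \<in> sets borel \<Longrightarrow> emeasure M (B \<times> UNIV) = emeasure lborel (B \<inter> {0..1})"
    "\<And>B. B \<in> sets borel \<Longrightarrow> emeasure M (UNIV \<times> B) = emeasure lborel (B \<inter> {0..1})"
    and C: "\<And>u v. u \<in> {0..1} \<Longrightarrow> v \<in> {0..1} \<Longrightarrow> C u v = measure M ({..u} \<times> {..v})"
    by (rule coupling) (rule that)
  interpret prob_space M by (rule M)
  note [measurable_cong] = M(2)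
  have [measurable]: "fst \<in> borel_measurable (borel :: (real \<times> real) measure)"
    by (intro borel_measurable_continuous_onI continuous_intros)
  have [measurable]: "UNIV \<times> {..v} \<in> sets (borel :: (real \<times> real) measure)"
    by (intro borel_Times) auto
  define \<nu> where "\<nu> = distr (density M (indicator (UNIV \<times> {..v}))) borel fst"
  have sp: "space M = UNIV" using sets_eq_imp_space_eq[OF M(2)] by simp
  have \<nu>: "emeasure \<nu> B = emeasure M (B \<times> {..v})" if [measurable]: "B \<in> sets borel" for B
  proof -
    have [measurable]: "B \<times> UNIV \<in> sets (borel :: (real \<times> real) measure)" by (intro borel_Times) auto
    have "emeasure \<nu> B = emeasure (density M (indicator (UNIV \<times> {..v}))) (B \<times> UNIV)"
      unfolding \<nu>_def by (subst emeasure_distr) (auto simp: sp intro!: arg_cong[where f = "emeasure _"])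
    also have "\<dots> = (\<integral>\<^sup>+x. indicator (B \<times> {..v}) x \<partial>M)"
      by (subst emeasure_density) (auto intro!: nn_integral_cong simp: M indicator_def)
    also have "\<dots> = emeasure M (B \<times> {..v})"
      by (intro nn_integral_indicator) (auto simp: M intro!: borel_Times)
    finally show ?thesis .
  qed
  have le: "emeasure \<nu> B \<le> emeasure lborel B" if [measurable]: "B \<in> sets borel" for B
  proof -
    have "emeasure M (B \<times> {..v}) \<le> emeasure M (B \<times> UNIV)"
      by (intro emeasure_mono) (auto simp: M intro!: borel_Times)
    also have "\<dots> \<le> emeasure lborel B" using that by (subst M(3)) (auto intro!: emeasure_mono)
    finally show ?thesis using \<nu>[OF that] by simp
  qed
  have "finite_measure \<nu>"
    by (rule finite_measureI) (use \<nu>[of UNIV] in \<open>auto simp: \<nu>_def\<close>)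
  moreover have "sets \<nu> = sets borel" by (simp add: \<nu>_def)
  ultimately have \<nu>fin: "sets \<nu> = sets borel" "finite_measure \<nu>" by simp_all
  obtain h :: "real \<Rightarrow> real" where h: "h \<in> borel_measurable borel" "\<And>x. 0 \<le> h x" "\<And>x. h x \<le> 1"
    "\<And>s t. s \<le> t \<Longrightarrow> (h has_integral (measure \<nu> {..t} - measure \<nu> {..s})) {s..t}"
    "negligible {x. \<not> ((\<lambda>t. measure \<nu> {..t}) has_real_derivative h x) (at x)}"
    by (rule measure_le_lborel_AE_derivative[OF \<nu>fin le]) (assumption, rule that)
  have CF: "C t v = measure \<nu> {..t}" if "t \<in> {0..1}" for t
    using that v \<nu>[of "{..t}"] by (simp add: C measure_def)
  show thesis
  proof (rule that[OF h(1-3)])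
    show "(h has_integral (C t v - C s v)) {s..t}" if "0 \<le> s" "s \<le> t" "t \<le> 1" for s t
      using h(4)[of s t] that by (simp add: CF)
    have "partial1 C t v = h t"
      if t: "0 < t" "t < 1" and der: "((\<lambda>t. measure \<nu> {..t}) has_real_derivative h t) (at t)" for t
    proof -
      have "((\<lambda>t. C t v) has_real_derivative h t) (at t)"
        by (rule has_field_derivative_transform_within_open[OF der, of "{0<..<1}"]) (use t in \<open>auto simp: CF\<close>)
      then show ?thesis unfolding partial1_def by (rule DERIV_imp_deriv)
    qed
    then have "{t \<in> {0..1}. partial1 C t v \<noteq> h t}
        \<subseteq> {x. \<not> ((\<lambda>t. measure \<nu> {..t}) has_real_derivative h x) (at x)} \<union> {0, 1}"
      by force
    moreover have "negligible ({x. \<not> ((\<lambda>t. measure \<nu> {..t}) has_real_derivative h x) (at x)} \<union> {0, 1})"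
      using h(5) by (intro negligible_Un) auto
    ultimately show "negligible {t \<in> {0..1}. partial1 C t v \<noteq> h t}" by (rule negligible_subset[rotated])
  qed
qed

lemma partial2_density:
  assumes u: "u \<in> {0..1}"
  obtains h :: "real \<Rightarrow> real" where "h \<in> borel_measurable borel" "\<And>x. 0 \<le> h x" "\<And>x. h x \<le> 1"
    "\<And>s t. \<lbrakk>0 \<le> s; s \<le> t; t \<le> 1\<rbrakk> \<Longrightarrow> (h has_integral (C u t - C u s)) {s..t}"
    "negligible {t \<in> {0..1}. partial2 C u t \<noteq> h t}"
  by (rule copula.partial1_density[OF transpose u]) (rule that, auto simp: partial1_def partial2_def)

lemma partial1_has_integral:
  assumes "v \<in> {0..1}" "0 \<le> s" "s \<le> t" "t \<le> 1"
  shows "((\<lambda>x. partial1 C x v) has_integral (C t v - C s v)) {s..t}"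
proof -
  obtain h :: "real \<Rightarrow> real" where h: "h \<in> borel_measurable borel" "\<And>x. 0 \<le> h x" "\<And>x. h x \<le> 1"
    "\<And>s t. \<lbrakk>0 \<le> s; s \<le> t; t \<le> 1\<rbrakk> \<Longrightarrow> (h has_integral (C t v - C s v)) {s..t}"
    "negligible {t \<in> {0..1}. partial1 C t v \<noteq> h t}"
    by (rule partial1_density[OF assms(1)]) (rule that)
  show ?thesis by (rule has_integral_spike[OF h(5) _ h(4)]) (use assms in auto)
qed

lemma partial2_has_integral:
  assumes "u \<in> {0..1}" "0 \<le> s" "s \<le> t" "t \<le> 1"
  shows "((\<lambda>x. partial2 C u x) has_integral (C u t - C u s)) {s..t}"
  using copula.partial1_has_integral[OF transpose assms] unfolding partial1_def partial2_def .

text \<open>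
  The Markov product is a Lebesgue integral of derivatives that may be unspecified on a null set;
  replacing them by bounded Borel densities shows that the integral exists, so that the calculus of
  gauge integrals applies to it.
\<close>

lemma markov_product_has_integral:
  assumes u: "u \<in> {0..1}" and v: "v \<in> {0..1}"
  shows "((\<lambda>t. partial2 C u t * partial1 C t v) has_integral markov_product C C u v) {0..1}"
proof -
  obtain h1 :: "real \<Rightarrow> real" where h1: "h1 \<in> borel_measurable borel" "\<And>x. 0 \<le> h1 x" "\<And>x. h1 x \<le> 1"
    "\<And>s t. \<lbrakk>0 \<le> s; s \<le> t; t \<le> 1\<rbrakk> \<Longrightarrow> (h1 has_integral (C t v - C s v)) {s..t}"
    "negligible {t \<in> {0..1}. partial1 C t v \<noteq> h1 t}"
    by (rule partial1_density[OF v]) (rule that)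
  obtain h2 :: "real \<Rightarrow> real" where h2: "h2 \<in> borel_measurable borel" "\<And>x. 0 \<le> h2 x" "\<And>x. h2 x \<le> 1"
    "\<And>s t. \<lbrakk>0 \<le> s; s \<le> t; t \<le> 1\<rbrakk> \<Longrightarrow> (h2 has_integral (C u t - C u s)) {s..t}"
    "negligible {t \<in> {0..1}. partial2 C u t \<noteq> h2 t}"
    by (rule partial2_density[OF u]) (rule that)
  have "(\<lambda>t. h2 t * h1 t) absolutely_integrable_on {0..1}"
  proof (rule measurable_bounded_by_integrable_imp_absolutely_integrable)
    have "(\<lambda>t. h2 t * h1 t) \<in> borel_measurable lborel" using h1 h2 by simp
    then show "(\<lambda>t. h2 t * h1 t) \<in> borel_measurable (lebesgue_on {0..1})"
      by (intro measurable_restrict_space1 measurable_completion)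
    show "(\<lambda>_. 1 :: real) integrable_on {0..1 :: real}" using has_integral_const_real[of 1 0 1] by blast
    show "norm (h2 t * h1 t) \<le> 1" for t
      using h1(2,3)[of t] h2(2,3)[of t] by (simp add: mult_le_one)
  qed simp
  then have "(\<lambda>t. partial2 C u t * partial1 C t v) absolutely_integrable_on {0..1}"
    by (rule absolutely_integrable_spike[OF _ negligible_Un[OF h1(5) h2(5)]]) auto
  then show ?thesis unfolding markov_product_def by (rule has_integral_set_lebesgue)
qed

lemma C_le:
  assumes "u \<in> {0..1}" "v \<in> {0..1}"
  shows "C u v \<le> u" "C u v \<le> v"
  using two_increasing[of 0 u v 1] two_increasing[of u 1 0 v] assms margins margins'
  by auto

lemma C_mono2:
  assumes "u \<in> {0..1}" "0 \<le> v" "v \<le> v'" "v' \<le> 1"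
  shows "C u v \<le> C u v'" "C u v' - C u v \<le> v' - v"
  using two_increasing[of 0 u v v'] two_increasing[of u 1 v v'] assms margins'
  by auto

section \<open>Stochastically monotone idempotents are ordinal sums\<close>

lemma version_has_integral:
  assumes v: "v \<in> {0..1}" and g: "negligible {t \<in> {0..1}. partial1 C t v \<noteq> g t}"
    and "0 \<le> s" "s \<le> t" "t \<le> 1"
  shows "(g has_integral (C t v - C s v)) {s..t}"
  by (rule has_integral_spike[OF g _ partial1_has_integral[OF v assms(3-5)]]) (use assms in auto)

text \<open>
  Idempotency says that \<open>g\<close> is orthogonal to the derivative of \<open>t \<mapsto> min u t - C u t\<close>: against the
  step function it integrates to \<open>C u v\<close>, against \<open>\<partial>\<^sub>2C u\<close> to the Markov product.
\<close>

lemma version_plateau: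
  assumes idem: "idempotent_copula C" and u: "u \<in> {0..1}" and v: "v \<in> {0..1}"
    and g: "mono_on {0..1} g \<or> antimono_on {0..1} g"
    and ver: "negligible {t \<in> {0..1}. partial1 C t v \<noteq> g t}"
    and pq: "0 \<le> p" "p < q" "q \<le> 1"
    and less: "\<And>t. \<lbrakk>p \<le> t; t \<le> q\<rbrakk> \<Longrightarrow> C u t < min u t"
  shows "g p = g q"
proof -
  define \<phi> where "\<phi> t = min u t - C u t" for t
  define \<phi>' where "\<phi>' t = (if t \<le> u then 1 else 0) - partial2 C u t" for t
  show ?thesis
  proof (rule monotone_weight_plateau[where \<phi> = \<phi> and \<phi>' = \<phi>', OF _ _ _ _ g _ pq])
    show "(\<phi>' has_integral (\<phi> t - \<phi> s)) {s..t}" if "0 \<le> s" "s \<le> t" "t \<le> 1" for s t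
      using has_integral_diff[OF has_integral_step[OF that(2), of u] partial2_has_integral[OF u that]]
      unfolding \<phi>_def \<phi>'_def by (simp add: algebra_simps)
    show "0 \<le> \<phi> t" if "0 \<le> t" "t \<le> 1" for t
      using C_le[OF u, of t] that by (simp add: \<phi>_def)
    show "\<phi> 0 = 0" "\<phi> 1 = 0" using margins[OF u] u by (auto simp: \<phi>_def)
    have "((\<lambda>t. partial2 C u t * partial1 C t v) has_integral C u v) {0..1}"
      using markov_product_has_integral[OF u v] idem u v by (simp add: idempotent_copula_def)
    then have 1: "((\<lambda>t. partial2 C u t * g t) has_integral C u v) {0..1}"
      by (rule has_integral_spike[OF ver, rotated]) auto
    have "(g has_integral (C u v)) {0..u}"
      using version_has_integral[OF v ver, of 0 u] u margins'[OF v] by simp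
    then have "((\<lambda>t. if t \<in> {0..u} then g t else 0) has_integral (C u v)) {0..1}"
      using u by (subst has_integral_restrict) auto
    from has_integral_diff[OF this 1]
    have "((\<lambda>t. (if t \<in> {0..u} then g t else 0) - partial2 C u t * g t) has_integral 0) {0..1}" by simp
    then show "((\<lambda>t. g t * \<phi>' t) has_integral 0) {0..1}"
      by (rule has_integral_eq[rotated]) (auto simp: \<phi>'_def algebra_simps)
    show "0 < \<phi> t" if "p \<le> t" "t \<le> q" for t
      using less[OF that] by (simp add: \<phi>_def)
  qed
qed

definition cuts :: "real set" where
  "cuts = {x \<in> {0..1}. \<forall>u\<in>{0..1}. C u x = min u x}"

lemma continuous_C2: "u \<in> {0..1} \<Longrightarrow> continuous_on {0..1} (C u)"
proof (rule continuous_on_subset[OF lipschitz_on_continuous_on, of 1 "{0..1}"])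
  assume u: "u \<in> {0..1}"
  show "1-lipschitz_on {0..1} (C u)"
  proof (rule lipschitz_onI)
    fix x y :: real assume "x \<in> {0..1}" "y \<in> {0..1}"
    then show "dist (C u x) (C u y) \<le> 1 * dist x y"
      using C_mono2[OF u, of x y] C_mono2[OF u, of y x] by (cases "x \<le> y") (auto simp: dist_real_def)
  qed simp
qed simp

lemma closed_cuts: "closed cuts"
proof -
  have "closed {x \<in> {0..1}. C u x - min u x \<in> {0}}" if "u \<in> {0..1}" for u
    by (rule continuous_closed_preimage[unfolded vimage_def Int_def mem_Collect_eq])
       (auto intro!: continuous_intros continuous_C2 that)
  then have "closed (\<Inter>u\<in>{0..1}. {x \<in> {0..1}. C u x - min u x \<in> {0}})" by blast
  also have "\<dots> = cuts" by (force simp: cuts_def)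
  finally show ?thesis .
qed

lemma cuts_ends: "0 \<in> cuts" "1 \<in> cuts"
  using margins by (auto simp: cuts_def)

definition gaps :: "(real \<times> real) set" where
  "gaps = {(a, b). a \<in> cuts \<and> b \<in> cuts \<and> a < b \<and> {a<..<b} \<inter> cuts = {}}"

lemma gap_around:
  assumes v: "v \<in> {0..1}" "v \<notin> cuts"
  obtains a b where "(a, b) \<in> gaps" "a < v" "v < b"
proof -
  \<comment> \<open>the nearest cuts on either side of \<open>v\<close>\<close>
  define A where "A = cuts \<inter> {..v}"
  define B where "B = cuts \<inter> {v..}"
  have A: "closed A" "A \<noteq> {}" "bdd_above A" and B: "closed B" "B \<noteq> {}" "bdd_below B"
    using closed_cuts cuts_ends v by (auto simp: A_def B_def intro!: closed_Int bdd_above_Int2 bdd_below_Int2)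
  have a: "Sup A \<in> A" and b: "Inf B \<in> B"
    using closed_contains_Sup[OF A(2,3,1)] closed_contains_Inf[OF B(2,3,1)] by auto
  have "x \<notin> cuts" if "Sup A < x" "x < Inf B" for x
  proof
    assume "x \<in> cuts"
    then have "x \<in> A \<or> x \<in> B" by (auto simp: A_def B_def)
    then show False using cSup_upper[OF _ A(3), of x] cInf_lower[OF _ B(3), of x] that by auto
  qed
  moreover have "Sup A \<in> cuts" "Sup A \<le> v" "Inf B \<in> cuts" "v \<le> Inf B" using a b by (auto simp: A_def B_def)
  moreover then have "Sup A \<noteq> v" "Inf B \<noteq> v" using v by auto
  ultimately show thesis by (intro that[of "Sup A" "Inf B"]) (auto simp: gaps_def)
qed

text \<open>
  Cuts on both sides of \<open>v\<close> pin \<open>C(\<cdot>, v)\<close> to its upper bound away from them: left of \<open>a\<close> because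
  \<open>C u v \<ge> C u a = u\<close>, and right of \<open>b\<close> because the mass of \<open>(u, 1] \<times> [0, v]\<close> is at most that of
  \<open>(u, 1] \<times> [0, b]\<close>, which is \<open>0\<close>.
\<close>

lemma C_outside_gap:
  assumes ab: "a \<in> cuts" "b \<in> cuts" "a \<le> v" "v \<le> b" and u: "u \<in> {0..1}" "u \<le> a \<or> b \<le> u"
  shows "C u v = min u v"
proof -
  have r: "0 \<le> a" "b \<le> 1" and a: "C u a = min u a" and b: "C u b = min u b"
    using ab u by (auto simp: cuts_def)
  show ?thesis
    using u(2)
  proof
    assume "u \<le> a"
    then show ?thesis using C_mono2[of u a v] C_le[of u v] a ab u r by auto
  next
    assume "b \<le> u"
    then show ?thesis using two_increasing[of u 1 v b] C_le[of u v] b ab u r margins'[of v] margins'[of b] by auto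
  qed
qed

text \<open>
  A point \<open>x\<close> of the gap is no cut, so \<open>C w x < min w x\<close> for some \<open>w\<close>, and by continuity the same \<open>w\<close>
  works near \<open>x\<close>; hence \<open>g\<close> is locally constant on the gap. Being connected, the gap carries a single
  value of \<open>g\<close>, which is the slope between the known values \<open>C a v = a\<close> and \<open>C b v = v\<close>.
\<close>

lemma C_inside_gap:
  assumes idem: "idempotent_copula C" and ab: "(a, b) \<in> gaps"
    and g: "mono_on {0..1} g \<or> antimono_on {0..1} g"
    and ver: "negligible {t \<in> {0..1}. partial1 C t v \<noteq> g t}"
    and v: "a < v" "v < b" and u: "a < u" "u < b"
  shows "C u v = a + (u - a) * (v - a) / (b - a)"
proof -
  have cuts: "a \<in> cuts" "b \<in> cuts" and r: "0 \<le> a" "b \<le> 1" using ab by (auto simp: gaps_def cuts_def)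
  have v01: "v \<in> {0..1}" using v r by auto
  have loc: "\<forall>\<^sub>F y in at x within {a<..<b}. g x = g y" if x: "x \<in> {a<..<b}" for x
  proof -
    have "x \<notin> cuts" "x \<in> {0..1}" using x ab r by (auto simp: gaps_def)
    then obtain w where w: "w \<in> {0..1}" "C w x \<noteq> min w x" by (auto simp: cuts_def)
    then have less: "C w x < min w x" using C_le[of w x] \<open>x \<in> {0..1}\<close> by auto
    have "continuous_on {a<..<b} (\<lambda>t. min w t - C w t)"
      by (intro continuous_intros continuous_on_subset[OF continuous_C2[OF w(1)]]) (use r in auto)
    then have "open ({a<..<b} \<inter> (\<lambda>t. min w t - C w t) -` {0<..})"
      by (intro continuous_open_preimage) auto
    then obtain e where e: "e > 0" "ball x e \<subseteq> {a<..<b} \<inter> (\<lambda>t. min w t - C w t) -` {0<..}"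
      using x less by (auto elim!: openE)
    have eq: "g p = g q" if "p \<in> ball x e" "q \<in> ball x e" "p < q" for p q
    proof (rule version_plateau[OF idem w(1) v01 g ver _ \<open>p < q\<close>])
      have pq: "p \<in> {a<..<b}" "q \<in> {a<..<b}" using that e(2) by blast+
      then show "0 \<le> p" "q \<le> 1" using r by auto
      fix t assume "p \<le> t" "t \<le> q"
      then have "t \<in> ball x e" using that(1,2) by (auto simp: dist_real_def)
      then have "t \<in> (\<lambda>t. min w t - C w t) -` {0<..}" using e(2) by blast
      then show "C w t < min w t" by simp
    qed
    have "g x = g y" if y: "y \<in> ball x e" for y
    proof (cases x y rule: linorder_cases)
      case less
      show ?thesis by (rule eq[OF _ y less]) (use e(1) in simp)
    next
      case greater
      show ?thesis by (rule eq[OF y _ greater, symmetric]) (use e(1) in simp)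
    qed simp
    then show ?thesis
      unfolding eventually_at using e(1) by (intro exI[of _ e]) (auto simp: dist_commute)
  qed
  have const: "g t = g u" if "t \<in> {a<..<b}" for t
    using connected_local_const[OF connected_Ioo that, of u g] u loc by simp
  \<comment> \<open>any point of the gap can name the common value of \<open>g\<close>; here it is \<open>u\<close>\<close>
  have lin: "C t v - C a v = g u * (t - a)" if t: "a \<le> t" "t \<le> b" for t
  proof (rule has_integral_unique)
    show "(g has_integral (C t v - C a v)) {a..t}"
      using version_has_integral[OF v01 ver] t r by simp
    have "((\<lambda>_. g u) has_integral g u * (t - a)) {a..t}"
      using has_integral_const_real[of "g u" a t] t by (simp add: mult.commute)
    then show "(g has_integral (g u * (t - a))) {a..t}"
      by (rule has_integral_spike_finite[of "{a, t}", rotated 2]) (use const t in auto)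
  qed
  have "C a v = a" "C b v = v"
    using C_outside_gap[OF cuts, of v] v r ab by (auto simp: gaps_def)
  then have "g u * (b - a) = v - a" "C u v = a + g u * (u - a)" using lin[of b] lin[of u] u by auto
  moreover then have "g u = (v - a) / (b - a)" using v by (simp add: field_simps)
  ultimately show ?thesis by simp
qed

lemma gaps_eqI:
  assumes "(a, b) \<in> gaps" "(c, d) \<in> gaps" "a < x" "x < b" "c < x" "x < d"
  shows "a = c" "b = d"
proof -
  have "a \<notin> {c<..<d}" "b \<notin> {c<..<d}" "c \<notin> {a<..<b}" "d \<notin> {a<..<b}"
    using assms(1,2) by (auto simp: gaps_def)
  then show "a = c" "b = d" using assms(3-) by auto
qed

text \<open>
  Gaps are pairwise disjoint nonempty open intervals, since their end points are cuts.
\<close>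

lemma countable_gaps: "countable gaps"
proof -
  have inj: "inj_on (\<lambda>(a, b). {a<..<b}) gaps"
  proof (rule inj_onI, clarify)
    fix a b c d assume g: "(a, b) \<in> gaps" "(c, d) \<in> gaps" "{a<..<b} = {c<..<d}"
    then have "a < b" by (auto simp: gaps_def)
    then obtain x where "x \<in> {a<..<b}" using dense by auto
    moreover from this have "x \<in> {c<..<d}" using g(3) by blast
    ultimately show "a = c \<and> b = d" using gaps_eqI[OF g(1,2), of x] by auto
  qed
  have "countable ((\<lambda>(a, b). {a<..<b}) ` gaps)"
  proof (rule countable_disjoint_open_subsets)
    show "pairwise disjnt ((\<lambda>(a, b). {a<..<b}) ` gaps)"
    proof (rule pairwiseI)
      fix S T assume "S \<in> (\<lambda>(a, b). {a<..<b}) ` gaps" "T \<in> (\<lambda>(a, b). {a<..<b}) ` gaps" "S \<noteq> T"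
      then obtain a b c d where S: "S = {a<..<b}" "(a, b) \<in> gaps" and T: "T = {c<..<d}" "(c, d) \<in> gaps"
        by auto
      have False if "x \<in> S" "x \<in> T" for x
        using gaps_eqI[OF S(2) T(2), of x] that S(1) T(1) \<open>S \<noteq> T\<close> by simp
      then show "disjnt S T" unfolding disjnt_def by blast
    qed
  qed auto
  then show ?thesis using inj by (rule countable_image_inj_on)
qed

lemma stoch_monotone1_idempotent_imp_ordinal_sum:
  assumes "stoch_monotone1 C" and idem: "idempotent_copula C"
  shows "is_ordinal_sum_of_Pi C"
proof -
  have version: "\<exists>g. (mono_on {0..1} g \<or> antimono_on {0..1} g) \<and>
      negligible {t \<in> {0..1}. partial1 C t v \<noteq> g t}" if "v \<in> {0..1}" for v
  proof -
    have "\<exists>g. (mono_on {0..1} g \<or> antimono_on {0..1} g) \<and>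
        (AE u in lebesgue. u \<in> {0..1} \<longrightarrow> partial1 C u v = g u)"
      using assms(1) that
      unfolding stoch_monotone1_def stoch_increasing1_def stoch_decreasing1_def by blast
    then show ?thesis unfolding AE_lebesgue_iff_negligible not_imp .
  qed
  define I where "I = to_nat_on gaps ` gaps"
  define a where "a k = fst (from_nat_into gaps k)" for k
  define b where "b k = snd (from_nat_into gaps k)" for k
  have I: "(a k, b k) \<in> gaps" if "k \<in> I" for k
    using that countable_gaps by (auto simp: I_def a_def b_def)
  have I_inj: "k = l" if "k \<in> I" "l \<in> I" "a k = a l" "b k = b l" for k l
    using that countable_gaps by (auto simp: I_def a_def b_def)
  have I_surj: "\<exists>k\<in>I. a k = c \<and> b k = d" if "(c, d) \<in> gaps" for c d
    using that countable_gaps by (intro bexI[of _ "to_nat_on gaps (c, d)"]) (auto simp: I_def a_def b_def)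
  show ?thesis
    unfolding is_ordinal_sum_of_Pi_def
  proof (intro conjI exI ballI impI)
    show "is_copula C" by (rule is_copula)
    show "0 \<le> a k" "a k < b k" "b k \<le> 1" if "k \<in> I" for k
      using I[OF that] by (auto simp: gaps_def cuts_def)
    show "disjoint_family_on (\<lambda>k. {a k<..<b k}) I"
      unfolding disjoint_family_on_def
    proof (intro ballI impI)
      fix k l assume "k \<in> I" "l \<in> I" "k \<noteq> l"
      have False if "x \<in> {a k<..<b k} \<inter> {a l<..<b l}" for x
        using gaps_eqI[OF I[OF \<open>k \<in> I\<close>] I[OF \<open>l \<in> I\<close>], of x] I_inj[OF \<open>k \<in> I\<close> \<open>l \<in> I\<close>] that \<open>k \<noteq> l\<close>
        by auto
      then show "{a k<..<b k} \<inter> {a l<..<b l} = {}" by blast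
    qed
    fix u v :: real assume u: "u \<in> {0..1}" and v: "v \<in> {0..1}"
    obtain g where g: "mono_on {0..1} g \<or> antimono_on {0..1} g" "negligible {t \<in> {0..1}. partial1 C t v \<noteq> g t}"
      using version[OF v] by blast
    show "C u v = a k + (b k - a k) * Pi_copula ((u - a k) / (b k - a k)) ((v - a k) / (b k - a k))"
      if "k \<in> I" "u \<in> {a k<..<b k} \<and> v \<in> {a k<..<b k}" for k
    proof -
      have "b k - a k \<noteq> 0" using that by auto
      then show ?thesis
        using C_inside_gap[OF idem I[OF that(1)] g] that by (simp add: Pi_copula_def)
    qed
    assume out: "\<not> (\<exists>k\<in>I. u \<in> {a k<..<b k} \<and> v \<in> {a k<..<b k})"
    show "C u v = upper_copula u v"
    proof (cases "v \<in> cuts")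
      case True
      then show ?thesis using u by (auto simp: cuts_def upper_copula_def)
    next
      case False
      then obtain c d where cd: "(c, d) \<in> gaps" "c < v" "v < d" using gap_around v by blast
      obtain k where k: "k \<in> I" "a k = c" "b k = d" using I_surj[OF cd(1)] by blast
      then have "u \<notin> {c<..<d}" using out cd by auto
      then have "u \<le> c \<or> d \<le> u" by auto
      then show ?thesis
        using C_outside_gap[of c d v u] cd u by (auto simp: gaps_def upper_copula_def)
    qed
  qed
qed

section \<open>Ordinal sums are stochastically increasing and idempotent\<close>

text \<open>
  One description of \<open>C(\<cdot>, v)\<close> for all \<open>v\<close>: if \<open>v\<close> lies in an interval of the family, take its end
  points, which are cuts since no other interval of the disjoint family contains them;
  otherwise \<open>v\<close> itself is a cut and \<open>a = b = v\<close>.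
\<close>

lemma ordinal_sum_profile:
  assumes "is_ordinal_sum_of_Pi C" and v: "v \<in> {0..1}"
  obtains a b where "a \<in> cuts" "b \<in> cuts" "a \<le> v" "v \<le> b"
    "\<And>u. \<lbrakk>a < u; u < b\<rbrakk> \<Longrightarrow> C u v = a + (v - a) / (b - a) * (u - a)"
proof -
  from assms(1) obtain I :: "nat set" and a b :: "nat \<Rightarrow> real" where
    ivl: "\<forall>k\<in>I. 0 \<le> a k \<and> a k < b k \<and> b k \<le> 1"
    and disj: "disjoint_family_on (\<lambda>k. {a k<..<b k}) I"
    and *: "\<And>u v. \<lbrakk>u \<in> {0..1}; v \<in> {0..1}\<rbrakk> \<Longrightarrow>
      (\<forall>k\<in>I. u \<in> {a k<..<b k} \<and> v \<in> {a k<..<b k} \<longrightarrow>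
         C u v = a k + (b k - a k) * Pi_copula ((u - a k) / (b k - a k)) ((v - a k) / (b k - a k))) \<and>
      (\<not> (\<exists>k\<in>I. u \<in> {a k<..<b k} \<and> v \<in> {a k<..<b k}) \<longrightarrow> C u v = upper_copula u v)"
    unfolding is_ordinal_sum_of_Pi_def by blast
  note ab = bspec[OF ivl]
  have cut: "x \<in> cuts" if "x \<in> {0..1}" "\<And>k. k \<in> I \<Longrightarrow> x \<notin> {a k<..<b k}" for x
  proof -
    have "C u x = upper_copula u x" if "u \<in> {0..1}" for u
      using *[OF that \<open>x \<in> {0..1}\<close>] \<open>\<And>k. k \<in> I \<Longrightarrow> x \<notin> {a k<..<b k}\<close> by blast
    then show ?thesis using that(1) unfolding cuts_def upper_copula_def by simp
  qed
  show thesis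
  proof (cases "\<exists>k\<in>I. v \<in> {a k<..<b k}")
    case True
    then obtain k where k: "k \<in> I" "v \<in> {a k<..<b k}" by blast
    have ends: "a k \<notin> {a l<..<b l} \<and> b k \<notin> {a l<..<b l}" if l: "l \<in> I" for l
    proof (cases "k = l")
      case False
      then have dj: "x \<notin> {a l<..<b l}" if "x \<in> {a k<..<b k}" for x
        using disj k(1) l that unfolding disjoint_family_on_def by blast
      show ?thesis
      proof (intro conjI notI)
        assume "a k \<in> {a l<..<b l}"
        then obtain x where "a k < x" "x < min (b k) (b l)"
          using dense[of "a k" "min (b k) (b l)"] ab[OF k(1)] by auto
        then show False using dj[of x] \<open>a k \<in> {a l<..<b l}\<close> by simp
      next
        assume "b k \<in> {a l<..<b l}"
        then obtain x where "max (a k) (a l) < x" "x < b k"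
          using dense[of "max (a k) (a l)" "b k"] ab[OF k(1)] by auto
        then show False using dj[of x] \<open>b k \<in> {a l<..<b l}\<close> by simp
      qed
    qed simp
    show thesis
    proof
      have "a k \<in> {0..1}" "b k \<in> {0..1}" using ab[OF k(1)] by simp_all
      then show "a k \<in> cuts" "b k \<in> cuts" using ends cut by blast+
      show "C u v = a k + (v - a k) / (b k - a k) * (u - a k)" if "a k < u" "u < b k" for u
      proof -
        have "b k - a k \<noteq> 0" "u \<in> {0..1}" "u \<in> {a k<..<b k}" using ab[OF k(1)] that by auto
        moreover from this have "C u v = a k + (b k - a k) *
            Pi_copula ((u - a k) / (b k - a k)) ((v - a k) / (b k - a k))"
          using *[of u v] v k by blast
        ultimately show ?thesis by (simp add: Pi_copula_def mult.commute)
      qed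
    qed (use k in auto)
  next
    case False
    then have "v \<in> cuts" using cut[OF v] by blast
    then show thesis by (intro that[of v v]) auto
  qed
qed

text \<open>
  With \<open>c = (v - a) / (b - a)\<close> the slopes \<open>1, c, 0\<close> of \<open>C(\<cdot>, v)\<close> reduce the Markov product to
  \<open>C u a + c (C u b - C u a)\<close>, and \<open>C u a\<close>, \<open>C u b\<close> are minima because \<open>a\<close> and \<open>b\<close> are cuts.
  If \<open>a = b\<close>, then \<open>c = 0\<close> by the convention for division by zero, and the middle piece is empty.
\<close>

lemma ordinal_sum_imp_stoch_monotone_idempotent:
  assumes os: "is_ordinal_sum_of_Pi C"
  shows "stoch_increasing1 C" "idempotent_copula C"
proof -
  have key: "(\<exists>g. antimono_on {0..1} g \<and> (AE t in lebesgue. t \<in> {0..1} \<longrightarrow> partial1 C t v = g t)) \<and>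
      (\<forall>u\<in>{0..1}. markov_product C C u v = C u v)" if v: "v \<in> {0..1}" for v
  proof -
    obtain a b where cuts: "a \<in> cuts" "b \<in> cuts" and avb: "a \<le> v" "v \<le> b"
      and inside: "\<And>u. \<lbrakk>a < u; u < b\<rbrakk> \<Longrightarrow> C u v = a + (v - a) / (b - a) * (u - a)"
      using ordinal_sum_profile[OF os v] by blast
    have r: "0 \<le> a" "b \<le> 1" using cuts by (auto simp: cuts_def)
    define c where "c = (v - a) / (b - a)"
    have c01: "0 \<le> c" "c \<le> 1" using avb by (auto simp: c_def divide_le_eq_1)
    define g where "g t = (if t \<le> a then 1 else if t < b then c else 0)" for t
    have low: "C t v = t" if "0 \<le> t" "t \<le> a" for t
      using C_outside_gap[OF cuts avb, of t] that r avb by auto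
    have high: "C t v = v" if "b \<le> t" "t \<le> 1" for t
      using C_outside_gap[OF cuts avb, of t] that r avb by auto
    have der: "partial1 C t v = g t" if t: "t \<in> {0..1} - {0, 1, a, b}" for t
    proof -
      consider "t \<in> {0<..<a}" | "t \<in> {a<..<b}" | "t \<in> {b<..<1}" using t by force
      then have "((\<lambda>t. C t v) has_real_derivative g t) (at t)"
      proof cases
        case 1
        have "((\<lambda>t. t) has_real_derivative 1) (at t)" by (auto intro!: derivative_eq_intros)
        then have "((\<lambda>t. C t v) has_real_derivative 1) (at t)"
          by (rule has_field_derivative_transform_within_open[of _ _ _ "{0<..<a}"]) (use 1 low in auto)
        then show ?thesis using 1 by (simp add: g_def)
      next
        case 2
        have "((\<lambda>t. a + c * (t - a)) has_real_derivative c) (at t)" by (auto intro!: derivative_eq_intros)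
        then have "((\<lambda>t. C t v) has_real_derivative c) (at t)"
          by (rule has_field_derivative_transform_within_open[of _ _ _ "{a<..<b}"])
            (use 2 inside in \<open>auto simp: c_def\<close>)
        then show ?thesis using 2 by (simp add: g_def)
      next
        case 3
        have "((\<lambda>t. v) has_real_derivative 0) (at t)" by (auto intro!: derivative_eq_intros)
        then have "((\<lambda>t. C t v) has_real_derivative 0) (at t)"
          by (rule has_field_derivative_transform_within_open[of _ _ _ "{b<..<1}"]) (use 3 high in auto)
        then show ?thesis using 3 avb by (simp add: g_def)
      qed
      then show ?thesis unfolding partial1_def by (rule DERIV_imp_deriv)
    qed
    have neg: "negligible {0, 1, a, b}" by (rule negligible_finite) simp
    have "negligible {t. \<not> (t \<in> {0..1} \<longrightarrow> partial1 C t v = g t)}"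
      by (rule negligible_subset[OF neg]) (use der in blast)
    then have "AE t in lebesgue. t \<in> {0..1} \<longrightarrow> partial1 C t v = g t"
      by (simp only: AE_lebesgue_iff_negligible)
    moreover have "antimono_on {0..1} g"
    proof (rule monotone_onI)
      fix s t :: real assume "s \<le> t"
      then show "g t \<le> g s" using c01 avb unfolding g_def by (simp split: if_split)
    qed
    moreover have "markov_product C C u v = C u v" if u: "u \<in> {0..1}" for u
    proof -
      have 1: "((\<lambda>t. partial2 C u t * g t) has_integral C u a) {0..a}"
        by (rule has_integral_eq[OF _ partial2_has_integral[OF u, of 0 a, simplified margins[OF u] diff_0_right]])
          (use r avb in \<open>auto simp: g_def\<close>)
      have "((\<lambda>t. partial2 C u t * c) has_integral (C u b - C u a) * c) {a..b}"
        by (rule has_integral_mult_left[OF partial2_has_integral[OF u]]) (use r avb in auto)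
      then have 2: "((\<lambda>t. partial2 C u t * g t) has_integral (C u b - C u a) * c) {a..b}"
        by (rule has_integral_spike[of "{a, b}", rotated 2]) (auto simp: g_def)
      have 3: "((\<lambda>t. partial2 C u t * g t) has_integral 0) {b..1}"
        by (rule has_integral_spike[of "{a, b}" _ _ "\<lambda>_. 0"]) (use avb in \<open>auto simp: g_def\<close>)
      have "((\<lambda>t. partial2 C u t * g t) has_integral (C u a + (C u b - C u a) * c)) {0..1}"
        using has_integral_combine[OF _ _ 1 has_integral_combine[OF _ _ 2 3]] r avb by simp
      moreover have "((\<lambda>t. partial2 C u t * g t) has_integral markov_product C C u v) {0..1}"
        by (rule has_integral_spike[OF neg _ markov_product_has_integral[OF u v]]) (use der in simp)
      ultimately have "markov_product C C u v = C u a + (C u b - C u a) * c"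
        by (rule has_integral_unique[symmetric])
      also have "\<dots> = min u a + (min u b - min u a) * c" using cuts u by (simp add: cuts_def)
      also have "\<dots> = C u v"
      proof -
        consider "u \<le> a" | "a < u" "u < b" | "a < u" "b \<le> u" by linarith
        then show ?thesis
        proof cases
          case 1
          then show ?thesis using low[of u] u avb by simp
        next
          case 2
          then show ?thesis using inside[of u] by (simp add: c_def)
        next
          case 3
          have "a + (b - a) * c = v" using avb by (cases "a = b") (auto simp: c_def)
          then show ?thesis using 3 high[of u] u by simp
        qed
      qed
      finally show ?thesis .
    qed
    ultimately show ?thesis by blast
  qed
  show "stoch_increasing1 C" unfolding stoch_increasing1_def using key by blast
  show "idempotent_copula C" unfolding idempotent_copula_def using key by blast
qed

lemma stoch_monotone1_idempotent_iff_ordinal_sum: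
  "stoch_monotone1 C \<and> idempotent_copula C \<longleftrightarrow> is_ordinal_sum_of_Pi C"
  using stoch_monotone1_idempotent_imp_ordinal_sum ordinal_sum_imp_stoch_monotone_idempotent
  unfolding stoch_monotone1_def by blast

end

section \<open>Exchanging the components\<close>

lemma ordinal_sum_transpose:
  assumes "is_ordinal_sum_of_Pi C"
  shows "is_ordinal_sum_of_Pi (\<lambda>u v. C v u)"
proof -
  from assms obtain I :: "nat set" and a b :: "nat \<Rightarrow> real" where C: "is_copula C"
    "\<forall>k\<in>I. 0 \<le> a k \<and> a k < b k \<and> b k \<le> 1"
    "disjoint_family_on (\<lambda>k. {a k<..<b k}) I"
    and *: "\<And>u v. \<lbrakk>u \<in> {0..1}; v \<in> {0..1}\<rbrakk> \<Longrightarrow>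
      (\<forall>k\<in>I. u \<in> {a k<..<b k} \<and> v \<in> {a k<..<b k} \<longrightarrow>
         C u v = a k + (b k - a k) * Pi_copula ((u - a k) / (b k - a k)) ((v - a k) / (b k - a k))) \<and>
      (\<not> (\<exists>k\<in>I. u \<in> {a k<..<b k} \<and> v \<in> {a k<..<b k}) \<longrightarrow> C u v = upper_copula u v)"
    unfolding is_ordinal_sum_of_Pi_def by blast
  have inside: "C v u = a k + (b k - a k) * Pi_copula ((u - a k) / (b k - a k)) ((v - a k) / (b k - a k))"
    if "u \<in> {0..1}" "v \<in> {0..1}" "k \<in> I" "u \<in> {a k<..<b k} \<and> v \<in> {a k<..<b k}" for u v k
  proof -
    have "C v u = a k + (b k - a k) * Pi_copula ((v - a k) / (b k - a k)) ((u - a k) / (b k - a k))"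
      using *[OF that(2,1)] that(3,4) by blast
    then show ?thesis unfolding Pi_copula_def by (simp only: mult.commute)
  qed
  have outside: "C v u = upper_copula u v"
    if "u \<in> {0..1}" "v \<in> {0..1}" "\<not> (\<exists>k\<in>I. u \<in> {a k<..<b k} \<and> v \<in> {a k<..<b k})" for u v
  proof -
    have "C v u = upper_copula v u" using *[OF that(2,1)] that(3) by blast
    then show ?thesis unfolding upper_copula_def by (simp only: min.commute)
  qed
  show ?thesis
    unfolding is_ordinal_sum_of_Pi_def
    using is_copula_transpose[OF C(1)] C(2,3) inside outside
    by (intro conjI exI[of _ I] exI[of _ a] exI[of _ b] ballI impI) blast+
qed

lemma ordinal_sum_transpose_iff:
  "is_ordinal_sum_of_Pi (\<lambda>u v. C v u) \<longleftrightarrow> is_ordinal_sum_of_Pi C"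
  using ordinal_sum_transpose[of "\<lambda>u v. C v u"] ordinal_sum_transpose[of C] by (rule iffI)

lemma markov_product_transpose:
  "markov_product (\<lambda>u v. C v u) (\<lambda>u v. C v u) u v = markov_product C C v u"
  unfolding markov_product_def partial1_def partial2_def by (simp only: mult.commute)

lemma idempotent_transpose:
  assumes "idempotent_copula C" shows "idempotent_copula (\<lambda>u v. C v u)"
  unfolding idempotent_copula_def
proof (intro ballI)
  fix u v :: real assume "u \<in> {0..1}" "v \<in> {0..1}"
  with assms have "markov_product C C v u = C v u" unfolding idempotent_copula_def by blast
  then show "markov_product (\<lambda>u v. C v u) (\<lambda>u v. C v u) u v = C v u"
    unfolding markov_product_transpose[of C u v] .
qed

lemma idempotent_transpose_iff:
  "idempotent_copula (\<lambda>u v. C v u) \<longleftrightarrow> idempotent_copula C"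
  using idempotent_transpose[of "\<lambda>u v. C v u"] idempotent_transpose[of C] by (rule iffI)

lemma stoch_monotone1_transpose:
  "stoch_monotone1 (\<lambda>u v. C v u) \<longleftrightarrow> stoch_monotone2 C"
  unfolding stoch_monotone1_def stoch_monotone2_def stoch_increasing1_def stoch_decreasing1_def
    stoch_increasing2_def stoch_decreasing2_def partial1_def partial2_def by (rule refl)

theorem theorem5p1:
  fixes C :: "real \<Rightarrow> real \<Rightarrow> real"
  assumes "is_copula C"
  shows "(stoch_monotone1 C \<and> idempotent_copula C \<longleftrightarrow> is_ordinal_sum_of_Pi C) \<and>
         (stoch_monotone2 C \<and> idempotent_copula C \<longleftrightarrow> is_ordinal_sum_of_Pi C)"
proof -
  interpret copula C by unfold_locales (rule assms)
  have "stoch_monotone1 (\<lambda>u v. C v u) \<and> idempotent_copula (\<lambda>u v. C v u) \<longleftrightarrow>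
      is_ordinal_sum_of_Pi (\<lambda>u v. C v u)"
    by (rule copula.stoch_monotone1_idempotent_iff_ordinal_sum[OF transpose])
  then have "stoch_monotone2 C \<and> idempotent_copula C \<longleftrightarrow> is_ordinal_sum_of_Pi C"
    by (simp only: stoch_monotone1_transpose[of C] idempotent_transpose_iff[of C]
        ordinal_sum_transpose_iff[of C])
  with stoch_monotone1_idempotent_iff_ordinal_sum show ?thesis by (rule conjI)
qed

end
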